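(* Let $g(x)=\dfrac{x^2-1}{(x^2+1)(x^2+4)(x^2+9)}$ for $x\in\mathbb{R}$. Then $\left(\frac12,1\right)\in\mathcal F(g)$, i.e. the Gabor system $\mathcal G\left(g,\frac12,1\right)$ is a frame for $L^2(\mathbb{R})$.
   Context: For $g\in L^2(\mathbb{R})$ nonzero and $\alpha,\beta>0$, the Gabor system is $\mathcal G(g,\alpha,\beta)=\{x\mapsto e^{2\pi i\beta m x}g(x-\alpha k): k,m\in\mathbb{Z}\}$. It is a (Gabor) frame for $L^2(\mathbb{R})$ if there exist constants $A,B>0$ such that for every $f\in L^2(\mathbb{R})$, $A\|f\|^2\le\sum_{m,k\in\mathbb{Z}}|\langle f,e^{2\pi i\beta m\cdot}g(\cdot-\alpha k)\rangle|^2\le B\|f\|^2$. The frame set of $g$ is $\mathcal F(g)=\{(\alpha,\beta): \alpha,\beta>0,\ \mathcal G(g,\alpha,\beta)\text{ is a frame}\}$. *)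

theory Defs
  imports "HOL-Analysis.Analysis"
begin

text \<open>
  Elements of $L^2(R)$ are represented by functions rather than by classes modulo equality almost
  everywhere: inner products, norms and hence the frame inequalities depend only on the class.
\<close>

definition L2_functions :: "(real \<Rightarrow> complex) set" where
  "L2_functions = {f. f \<in> borel_measurable lebesgue \<and> integrable lebesgue (\<lambda>x. (cmod (f x))\<^sup>2)}"

definition L2_inner :: "(real \<Rightarrow> complex) \<Rightarrow> (real \<Rightarrow> complex) \<Rightarrow> complex" where
  "L2_inner f h = (LINT x|lebesgue. f x * cnj (h x))"

definition L2_norm :: "(real \<Rightarrow> complex) \<Rightarrow> real" where
  "L2_norm f = sqrt (LINT x|lebesgue. (cmod (f x))\<^sup>2)"

text \<open>
  Since \<open>infsum\<close> is 0 for families that are not summable, finiteness of the frame sum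
  has to be required explicitly.
\<close>

definition L2_frame :: "('i \<Rightarrow> real \<Rightarrow> complex) \<Rightarrow> bool" where
  "L2_frame h \<longleftrightarrow> range h \<subseteq> L2_functions \<and>
     (\<exists>A>0. \<exists>B>0. \<forall>f\<in>L2_functions.
        (\<lambda>i. (cmod (L2_inner f (h i)))\<^sup>2) summable_on UNIV \<and>
        A * (L2_norm f)\<^sup>2 \<le> (\<Sum>\<^sub>\<infinity>i. (cmod (L2_inner f (h i)))\<^sup>2) \<and>
        (\<Sum>\<^sub>\<infinity>i. (cmod (L2_inner f (h i)))\<^sup>2) \<le> B * (L2_norm f)\<^sup>2)"

definition gabor_system ::
    "(real \<Rightarrow> complex) \<Rightarrow> real \<Rightarrow> real \<Rightarrow> int \<times> int \<Rightarrow> real \<Rightarrow> complex" where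
  "gabor_system g \<alpha> \<beta> = (\<lambda>(k, m) x.
     exp (2 * complex_of_real pi * \<i> * complex_of_real \<beta> * of_int m * complex_of_real x)
       * g (x - \<alpha> * of_int k))"

definition gabor_frame_set :: "(real \<Rightarrow> complex) \<Rightarrow> (real \<times> real) set" where
  "gabor_frame_set g = {(\<alpha>, \<beta>). \<alpha> > 0 \<and> \<beta> > 0 \<and> L2_frame (gabor_system g \<alpha> \<beta>)}"

end

theory Submission
  imports Defs
begin

text \<open>
  Write \<open>e(t) = cis (2 * pi * t)\<close>. With the partial fraction expansion of \<open>g\<close>, its Fourier transform is
  \<open>- (pi / 12) * q * (1 - q)^2\<close>, where \<open>q = exp (- 2 * pi * |\<xi>|)\<close>: it never changes sign, decays
  exponentially and vanishes only at the origin. This is what makes the system a frame.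

  By density (\<open>L2_frame_if_dense\<close>) it is enough to bound the frame sum for a continuous \<open>f\<close> with compact
  support. As \<open>\<beta> = 1\<close>, the inner product of \<open>f\<close> with the \<open>(k, m)\<close>-th element of the system is the \<open>m\<close>-th
  Fourier coefficient of the 1-periodic function \<open>P_k(x) = \<Sum>n. f(x + n) * g(x + n - k/2)\<close>, so that
  Parseval's identity (\<open>parseval\<close>) turns the frame sum into the integral over \<open>0 \<le> x \<le> 1\<close> of
  \<open>\<Sum>k. |P_k(x)|^2\<close>. The squared norm of \<open>f\<close> is the integral of \<open>\<Sum>n. |f(x + n)|^2\<close>. Hence the frame
  inequalities follow from bounds, uniform in \<open>x\<close>, for \<open>\<Sum>k. |\<Sum>n. c_n * g(x + n - k/2)|^2\<close> against
  \<open>\<Sum>n. |c_n|^2\<close>, for finitely supported \<open>c\<close> (\<open>window_sum_bounds\<close>).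

  For fixed \<open>x\<close> the numbers \<open>g(x - l/2)\<close> are, up to the factor \<open>- 6 / pi\<close>, the Fourier coefficients of
  \<open>H(s) = e(2 * x * s) * K(z, s)\<close>, where \<open>z = e(2 * x)\<close>, \<open>K(z, s) = \<Sum>j. \<psi>(s + j) * z^j\<close>, and
  \<open>\<psi>(s) = q * (1 - q)^2\<close> with \<open>q = exp (- 4 * pi * |s|)\<close>
  (\<open>fourier_coeff_gabor_symbol\<close>; \<open>K\<close> is \<open>gabor_symbol\<close>). So \<open>\<Sum>n. c_n * g(x + n - k/2)\<close> is a Fourier
  coefficient of \<open>C * H\<close> with \<open>C(s) = \<Sum>n. c_n * e(2 * n * s)\<close>. Since \<open>C\<close> has period \<open>1/2\<close>, a second use of
  Parseval's identity leaves the integral over \<open>0 \<le> s \<le> 1/2\<close> of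
  \<open>|C(s)|^2 * (|K(z, s)|^2 + |K(z, s + 1/2)|^2)\<close>. By compactness it remains to show that \<open>K(z, s)\<close> and
  \<open>K(z, s + 1/2)\<close> have no common zero (\<open>gabor_symbol_no_common_zero\<close>).

  The symmetry \<open>|K(z, 1 - s)| = |K(z, s)|\<close> reduces this to \<open>K(z, s)\<close> and \<open>K(z, 1/2 - s)\<close>, with \<open>1/4 \<le> s \<le> 1/2\<close>
  without loss of generality. There the imaginary part of \<open>K(z, s)\<close> is \<open>Im z\<close> times a nonvanishing
  factor, so that a zero forces \<open>z = 1\<close> or \<open>z = - 1\<close>. For \<open>z = 1\<close> all terms of the series are positive.
  For \<open>z = - 1\<close> the series alternates and its terms decrease, so that it vanishes for \<open>s = 1/2\<close> only; but
  then the second function is \<open>K(- 1, 0)\<close>, whose series starts with \<open>\<psi>(0) = 0\<close> and which is negative.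
\<close>

section \<open>Parseval's identity on the unit interval\<close>

lemma has_integral_exp_unit_interval:
  assumes "l \<noteq> (0::complex)"
  shows "((\<lambda>s. exp (l * of_real s)) has_integral (exp l - 1) / l) {0..1}"
proof -
  have "((\<lambda>s. exp (l * of_real s) / l) has_vector_derivative exp (l * of_real s)) (at s within {0..1})" for s :: real
    by (rule has_vector_derivative_real_field) (use assms in \<open>auto intro!: derivative_eq_intros\<close>)
  then have "((\<lambda>s. exp (l * of_real s)) has_integral
      (exp (l * of_real 1) / l - exp (l * of_real 0) / l)) {0..1}"
    by (intro fundamental_theorem_of_calculus) auto
  then show ?thesis
    by (simp add: diff_divide_distrib)
qed

lemma has_integral_cis_unit_interval:
  "((\<lambda>t. cis (2 * pi * of_int n * t)) has_integral (if n = 0 then 1 else 0)) {0..1}"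
proof (cases "n = 0")
  case True
  then show ?thesis using has_integral_const_real[of "1::complex" 0 1] by simp
next
  case False
  have *: "cis (2 * pi * of_int n * t) = exp (\<i> * of_real (2 * pi * of_int n) * of_real t)" for t
    by (simp add: cis_conv_exp mult_ac)
  have "exp (\<i> * of_real (2 * pi * of_int n)) = 1"
    by (metis cis_conv_exp cis_multiple_2pi Ints_of_int)
  then show ?thesis
    unfolding * using has_integral_exp_unit_interval[of "\<i> * of_real (2 * pi * of_int n)"] False
    by simp
qed

definition fourier_coeff :: "(real \<Rightarrow> complex) \<Rightarrow> int \<Rightarrow> complex" where
  "fourier_coeff F n = integral {0..1} (\<lambda>t. F t * cis (- (2 * pi * of_int n * t)))"

lemma has_integral_fourier_coeff:
  assumes "continuous_on {0..1} F"
  shows "((\<lambda>t. F t * cis (- (2 * pi * of_int n * t))) has_integral fourier_coeff F n) {0..1}"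
  unfolding fourier_coeff_def
  by (rule integrable_integral, rule integrable_continuous_interval) (intro continuous_intros assms)

text \<open>
  The Pythagorean identity behind both halves of Parseval's identity: the choice \<open>b = fourier_coeff F\<close>
  gives Bessel's inequality, and any \<open>b\<close> for which the left-hand side is small gives the converse.
\<close>

lemma integral_cmod_diff_trig_poly:
  fixes F :: "real \<Rightarrow> complex"
  assumes F: "continuous_on {0..1} F" and S: "finite S"
  shows "integral {0..1} (\<lambda>t. (cmod (F t - (\<Sum>n\<in>S. b n * cis (2 * pi * of_int n * t))))\<^sup>2)
       = integral {0..1} (\<lambda>t. (cmod (F t))\<^sup>2) - (\<Sum>n\<in>S. (cmod (fourier_coeff F n))\<^sup>2)
         + (\<Sum>n\<in>S. (cmod (b n - fourier_coeff F n))\<^sup>2)" (is "?L = ?R")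
proof -
  let ?e = "\<lambda>n t. cis (2 * pi * of_int n * t)"
  note h = has_integral_fourier_coeff[OF F]
  have h': "((\<lambda>t. cnj (F t * cis (- (2 * pi * of_int n * t)))) has_integral cnj (fourier_coeff F n)) {0..1}" for n
    using has_integral_cnj[THEN iffD2, OF h[of n]] by (simp only: o_def)
  have hF: "((\<lambda>t. F t * cnj (F t)) has_integral integral {0..1} (\<lambda>t. F t * cnj (F t))) {0..1}"
    by (rule integrable_integral, rule integrable_continuous_interval) (intro continuous_intros F)
  have IF: "integral {0..1} (\<lambda>t. F t * cnj (F t)) = of_real (integral {0..1} (\<lambda>t. (cmod (F t))\<^sup>2))"
  proof -
    have "((\<lambda>t. (cmod (F t))\<^sup>2) has_integral integral {0..1} (\<lambda>t. (cmod (F t))\<^sup>2)) {0..1}"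
      by (rule integrable_integral, rule integrable_continuous_interval) (intro continuous_intros F)
    from has_integral_of_real[OF this, where 'b=complex] show ?thesis
      by (intro integral_unique) (simp only: complex_norm_square)
  qed
  have "((\<lambda>t. F t * cnj (F t) - (\<Sum>n\<in>S. cnj (b n) * (F t * cis (- (2 * pi * of_int n * t))))
          - (\<Sum>n\<in>S. b n * cnj (F t * cis (- (2 * pi * of_int n * t))))
          + (\<Sum>n\<in>S. \<Sum>m\<in>S. b n * cnj (b m) * ?e (n - m) t))
        has_integral integral {0..1} (\<lambda>t. F t * cnj (F t)) - (\<Sum>n\<in>S. cnj (b n) * fourier_coeff F n)
          - (\<Sum>n\<in>S. b n * cnj (fourier_coeff F n))
          + (\<Sum>n\<in>S. \<Sum>m\<in>S. b n * cnj (b m) * (if n - m = 0 then 1 else 0))) {0..1}"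
    by (intro has_integral_add has_integral_diff has_integral_sum has_integral_mult_right hF h h'
         has_integral_cis_unit_interval S)
  also have "(\<lambda>t. F t * cnj (F t) - (\<Sum>n\<in>S. cnj (b n) * (F t * cis (- (2 * pi * of_int n * t))))
          - (\<Sum>n\<in>S. b n * cnj (F t * cis (- (2 * pi * of_int n * t))))
          + (\<Sum>n\<in>S. \<Sum>m\<in>S. b n * cnj (b m) * ?e (n - m) t))
      = (\<lambda>t. of_real ((cmod (F t - (\<Sum>n\<in>S. b n * ?e n t)))\<^sup>2))"
  proof
    fix t
    let ?T = "\<Sum>n\<in>S. b n * ?e n t"
    have e: "?e (n - m) t = ?e n t * cis (- (2 * pi * of_int m * t))" for n m
      by (simp add: cis_mult algebra_simps)
    have cT: "cnj ?T = (\<Sum>n\<in>S. cnj (b n) * cis (- (2 * pi * of_int n * t)))"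
      by (simp add: cis_cnj)
    have 1: "(\<Sum>n\<in>S. cnj (b n) * (F t * cis (- (2 * pi * of_int n * t)))) = F t * cnj ?T"
      unfolding cT sum_distrib_left by (intro sum.cong) (simp_all only: mult_ac)
    have 2: "(\<Sum>n\<in>S. b n * cnj (F t * cis (- (2 * pi * of_int n * t)))) = cnj (F t) * ?T"
      unfolding sum_distrib_left by (intro sum.cong) (simp_all add: mult_ac cis_cnj)
    have 3: "(\<Sum>n\<in>S. \<Sum>m\<in>S. b n * cnj (b m) * ?e (n - m) t) = ?T * cnj ?T"
      unfolding cT sum_product e by (intro sum.cong) (simp_all only: mult_ac)
    have "of_real ((cmod (F t - ?T))\<^sup>2) = (F t - ?T) * cnj (F t - ?T)"
      by (rule complex_norm_square)
    also have "\<dots> = F t * cnj (F t) - F t * cnj ?T - cnj (F t) * ?T + ?T * cnj ?T"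
      unfolding complex_cnj_diff by (simp only: algebra_simps)
    finally show "F t * cnj (F t) - (\<Sum>n\<in>S. cnj (b n) * (F t * cis (- (2 * pi * of_int n * t))))
          - (\<Sum>n\<in>S. b n * cnj (F t * cis (- (2 * pi * of_int n * t))))
          + (\<Sum>n\<in>S. \<Sum>m\<in>S. b n * cnj (b m) * ?e (n - m) t)
      = of_real ((cmod (F t - ?T))\<^sup>2)"
      unfolding 1 2 3 by simp
  qed
  also have "integral {0..1} (\<lambda>t. F t * cnj (F t)) - (\<Sum>n\<in>S. cnj (b n) * fourier_coeff F n)
          - (\<Sum>n\<in>S. b n * cnj (fourier_coeff F n))
          + (\<Sum>n\<in>S. \<Sum>m\<in>S. b n * cnj (b m) * (if n - m = 0 then 1 else 0)) = of_real ?R"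
  proof -
    have d: "(\<Sum>n\<in>S. \<Sum>m\<in>S. b n * cnj (b m) * (if n - m = 0 then 1 else 0)) = (\<Sum>n\<in>S. b n * cnj (b n))"
    proof (rule sum.cong[OF refl])
      fix n assume "n \<in> S"
      have "(\<Sum>m\<in>S. b n * cnj (b m) * (if n - m = 0 then 1 else 0))
          = (\<Sum>m\<in>S. if n = m then b n * cnj (b m) else 0)"
        by (intro sum.cong) auto
      then show "(\<Sum>m\<in>S. b n * cnj (b m) * (if n - m = 0 then 1 else 0)) = b n * cnj (b n)"
        using S \<open>n \<in> S\<close> by simp
    qed
    have "of_real (\<Sum>n\<in>S. (cmod (b n - fourier_coeff F n))\<^sup>2) - of_real (\<Sum>n\<in>S. (cmod (fourier_coeff F n))\<^sup>2)
        = (\<Sum>n\<in>S. b n * cnj (b n) - cnj (b n) * fourier_coeff F n - b n * cnj (fourier_coeff F n))"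
      unfolding of_real_sum complex_norm_square sum_subtractf[symmetric]
      by (intro sum.cong) (simp_all add: algebra_simps)
    then show ?thesis
      unfolding d IF by (simp add: sum_subtractf sum.distrib algebra_simps)
  qed
  finally have "((\<lambda>t. Re (of_real ((cmod (F t - (\<Sum>n\<in>S. b n * ?e n t)))\<^sup>2))) has_integral Re (of_real ?R)) {0..1}"
    by (rule has_integral_Re)
  then show ?thesis by (simp add: integral_unique)
qed

text \<open>
  Closure under sums and monomials only, so that closure under products is a double induction on
  monomials; the normal form as a sum over distinct frequencies is recovered in \<open>trig_poly_as_sum\<close>.
\<close>

inductive trig_poly :: "(real \<Rightarrow> complex) \<Rightarrow> bool" where
  mono: "trig_poly (\<lambda>t. c * cis (2 * pi * of_int n * t))"
| add: "trig_poly p \<Longrightarrow> trig_poly q \<Longrightarrow> trig_poly (\<lambda>t. p t + q t)"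

lemma trig_poly_mult:
  assumes "trig_poly p" "trig_poly q" shows "trig_poly (\<lambda>t. p t * q t)"
  using assms(1)
proof (induction rule: trig_poly.induct)
  case (mono c n)
  show ?case using assms(2)
  proof (induction rule: trig_poly.induct)
    case (mono d m)
    have "(\<lambda>t. c * cis (2 * pi * of_int n * t) * (d * cis (2 * pi * of_int m * t)))
        = (\<lambda>t. (c * d) * cis (2 * pi * of_int (n + m) * t))"
      by (rule ext) (simp add: cis_mult[symmetric] algebra_simps)
    then show ?case by (simp only: trig_poly.mono)
  next
    case (add p q)
    then show ?case by (simp only: distrib_left trig_poly.add)
  qed
next
  case (add p1 p2)
  then show ?case by (simp only: distrib_right trig_poly.add)
qed

lemma trig_poly_const: "trig_poly (\<lambda>t. c)"
  using trig_poly.mono[of c 0] by simp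

lemma trig_poly_compose_real_polynomial:
  assumes "real_polynomial_function (p :: complex \<Rightarrow> real)"
  shows "trig_poly (\<lambda>t. of_real (p (cis (2 * pi * t))))"
  using assms
proof (induction rule: real_polynomial_function.induct)
  case (linear f)
  interpret bounded_linear f by fact
  have lin: "f z = f 1 * Re z + f \<i> * Im z" for z
  proof -
    have "f (Re z *\<^sub>R 1 + Im z *\<^sub>R \<i>) = Re z * f 1 + Im z * f \<i>"
      by (simp only: add scaleR real_scaleR_def)
    moreover have "Re z *\<^sub>R 1 + Im z *\<^sub>R \<i> = z" by (simp add: complex_eq_iff)
    ultimately show ?thesis by (simp add: mult.commute)
  qed
  have lincis: "f (cis (2 * pi * t)) = f 1 * cos (2 * pi * t) + f \<i> * sin (2 * pi * t)" for t
    by (subst lin) simp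
  have "complex_of_real (f (cis (2 * pi * t)))
      = ((f 1 - \<i> * f \<i>) / 2) * cis (2 * pi * of_int 1 * t) + ((f 1 + \<i> * f \<i>) / 2) * cis (2 * pi * of_int (-1) * t)" for t
    unfolding lincis complex_eq_iff by (simp add: field_simps)
  then show ?case by (simp only: trig_poly.intros)
next
  case (const c)
  then show ?case by (rule trig_poly_const)
next
  case (add f g)
  then show ?case by (simp only: of_real_add trig_poly.add)
next
  case (mult f g)
  then show ?case by (simp only: of_real_mult trig_poly_mult)
qed

lemma trig_poly_as_sum:
  assumes "trig_poly p"
  shows "\<exists>S b. finite S \<and> (\<forall>t. p t = (\<Sum>n\<in>S. b n * cis (2 * pi * of_int n * t)))"
  using assms
proof (induction rule: trig_poly.induct)
  case (mono c n)
  show ?case by (rule exI[of _ "{n}"], rule exI[of _ "\<lambda>_. c"]) simp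
next
  case (add p q)
  from add.IH(1) obtain S b where S: "finite S" and p: "\<And>t. p t = (\<Sum>n\<in>S. b n * cis (2 * pi * of_int n * t))"
    by (elim exE conjE) auto
  from add.IH(2) obtain S' b' where S': "finite S'" and q: "\<And>t. q t = (\<Sum>n\<in>S'. b' n * cis (2 * pi * of_int n * t))"
    by (elim exE conjE) auto
  let ?b = "\<lambda>n. (if n \<in> S then b n else 0) + (if n \<in> S' then b' n else 0)"
  have "p t + q t = (\<Sum>n\<in>S \<union> S'. ?b n * cis (2 * pi * of_int n * t))" for t
  proof -
    have "p t = (\<Sum>n\<in>S \<union> S'. (if n \<in> S then b n else 0) * cis (2 * pi * of_int n * t))"
      unfolding p by (rule sum.mono_neutral_cong_left) (use S S' in auto)
    moreover have "q t = (\<Sum>n\<in>S \<union> S'. (if n \<in> S' then b' n else 0) * cis (2 * pi * of_int n * t))"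
      unfolding q by (rule sum.mono_neutral_cong_left) (use S S' in auto)
    ultimately show ?thesis by (simp only: distrib_right sum.distrib)
  qed
  moreover have "finite (S \<union> S')" using S S' by simp
  ultimately show ?case by (intro exI conjI allI)
qed

text \<open>
  A function on the interval with equal values at the endpoints is a continuous function on the unit
  circle, where the Stone-Weierstrass theorem provides polynomials in the real and imaginary part of
  \<open>cis (2 * pi * t)\<close>.
\<close>

lemma trig_poly_dense:
  fixes F :: "real \<Rightarrow> complex"
  assumes F: "continuous_on {0..1} F" and per: "F 0 = F 1" and e: "e > 0"
  shows "\<exists>p. trig_poly p \<and> (\<forall>t\<in>{0..1}. cmod (F t - p t) < e)"
proof -
  define G where "G = F \<circ> (\<lambda>z. Arg2pi z / (2 * pi))"
  have "homotopic_loops UNIV F F"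
    using F per by (simp add: homotopic_loops_refl path_def pathstart_def pathfinish_def)
  from homotopic_loops_imp_homotopic_circlemaps[OF this]
  have G: "continuous_on (sphere 0 1) G"
    unfolding G_def by (rule homotopic_with_imp_continuous[THEN conjunct1])
  have GF: "G (cis (2 * pi * t)) = F t" if "t \<in> {0..1}" for t
  proof (cases "t = 1")
    case True
    then show ?thesis by (simp add: G_def per Arg2pi_of_real[of 1, simplified])
  next
    case False
    then have "Arg2pi (cis (2 * pi * t)) = 2 * pi * t"
      using that by (intro Arg2pi_unique[of 1]) (auto simp: cis_conv_exp)
    then show ?thesis by (simp add: G_def)
  qed
  obtain h where h: "polynomial_function h" "\<And>z. z \<in> sphere 0 1 \<Longrightarrow> cmod (G z - h z) < e"
    using Stone_Weierstrass_polynomial_function[OF _ G e] by auto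
  have r: "real_polynomial_function (\<lambda>z. Re (h z))" "real_polynomial_function (\<lambda>z. Im (h z))"
    using h(1) bounded_linear_Re bounded_linear_Im unfolding polynomial_function_def o_def by auto
  define p where "p = (\<lambda>t. of_real (Re (h (cis (2 * pi * t)))) + \<i> * of_real (Im (h (cis (2 * pi * t)))))"
  have "trig_poly p" unfolding p_def
    by (intro trig_poly.add trig_poly_mult trig_poly_const r[THEN trig_poly_compose_real_polynomial])
  moreover have "p t = h (cis (2 * pi * t))" for t
    by (simp add: p_def complex_eq_iff)
  moreover have "cmod (F t - h (cis (2 * pi * t))) < e" if "t \<in> {0..1}" for t
    using h(2)[of "cis (2 * pi * t)"] GF[OF that] by simp
  ultimately show ?thesis by (intro exI[of _ p]) simp
qed

theorem parseval:
  fixes F :: "real \<Rightarrow> complex"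
  assumes F: "continuous_on {0..1} F" and per: "F 0 = F 1"
  shows "((\<lambda>n. (cmod (fourier_coeff F n))\<^sup>2) has_sum integral {0..1} (\<lambda>t. (cmod (F t))\<^sup>2)) UNIV"
proof -
  let ?I = "integral {0..1} (\<lambda>t. (cmod (F t))\<^sup>2)"
  have bessel: "(\<Sum>n\<in>S. (cmod (fourier_coeff F n))\<^sup>2) \<le> ?I" if "finite S" for S
  proof -
    have "0 \<le> integral {0..1} (\<lambda>t. (cmod (F t - (\<Sum>n\<in>S. fourier_coeff F n * cis (2 * pi * of_int n * t))))\<^sup>2)"
      by (rule integral_nonneg) (auto intro!: integrable_continuous_interval continuous_intros F)
    then show ?thesis unfolding integral_cmod_diff_trig_poly[OF F that] by simp
  qed
  then have sm: "(\<lambda>n. (cmod (fourier_coeff F n))\<^sup>2) summable_on UNIV"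
    by (intro nonneg_bdd_above_summable_on bdd_aboveI2[where M = ?I]) auto
  have le: "infsum (\<lambda>n. (cmod (fourier_coeff F n))\<^sup>2) UNIV \<le> ?I"
    by (rule infsum_le_finite_sums[OF sm]) (use bessel in auto)
  have "?I \<le> infsum (\<lambda>n. (cmod (fourier_coeff F n))\<^sup>2) UNIV"
  proof (rule field_le_epsilon)
    fix e :: real assume "e > 0"
    then obtain p where p: "trig_poly p" "\<forall>t\<in>{0..1}. cmod (F t - p t) < sqrt e"
      using trig_poly_dense[OF F per, of "sqrt e"] by auto
    obtain S b where S: "finite S" "\<And>t. p t = (\<Sum>n\<in>S. b n * cis (2 * pi * of_int n * t))"
      using trig_poly_as_sum[OF p(1)] by blast
    have "?I - (\<Sum>n\<in>S. (cmod (fourier_coeff F n))\<^sup>2) \<le> integral {0..1} (\<lambda>t. (cmod (F t - p t))\<^sup>2)"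
      unfolding S(2) integral_cmod_diff_trig_poly[OF F S(1)] by (simp add: sum_nonneg)
    also have "\<dots> \<le> integral {0..1} (\<lambda>t::real. e)"
    proof (rule integral_le)
      show "(\<lambda>t. (cmod (F t - p t))\<^sup>2) integrable_on {0..1}" unfolding S(2)
        by (auto intro!: integrable_continuous_interval continuous_intros F)
      show "(cmod (F t - p t))\<^sup>2 \<le> e" if "t \<in> {0..1}" for t
        using power_mono[of "cmod (F t - p t)" "sqrt e" 2] p(2) that \<open>e > 0\<close> by (simp add: less_imp_le)
    qed auto
    also have "\<dots> = e" by simp
    finally have "?I \<le> (\<Sum>n\<in>S. (cmod (fourier_coeff F n))\<^sup>2) + e" by simp
    moreover have "(\<Sum>n\<in>S. (cmod (fourier_coeff F n))\<^sup>2) \<le> infsum (\<lambda>n. (cmod (fourier_coeff F n))\<^sup>2) UNIV"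
      by (rule finite_sum_le_infsum[OF sm S(1)]) auto
    ultimately show "?I \<le> infsum (\<lambda>n. (cmod (fourier_coeff F n))\<^sup>2) UNIV + e" by simp
  qed
  with le have "infsum (\<lambda>n. (cmod (fourier_coeff F n))\<^sup>2) UNIV = ?I" by simp
  with sm show ?thesis by (metis has_sum_infsum)
qed

lemma integral_cmod_trig_poly:
  assumes S: "finite S" and r: "inj_on r S"
  shows "integral {0..1} (\<lambda>t. (cmod (\<Sum>n\<in>S. c n * cis (2 * pi * of_int (r n) * t)))\<^sup>2) = (\<Sum>n\<in>S. (cmod (c n))\<^sup>2)"
proof -
  \<comment> \<open>The sign turns the distance of 0 to a trigonometric polynomial into the norm of the given one.\<close>
  define b where "b m = - c (inv_into S r m)" for m
  have b: "b (r n) = - c n" if "n \<in> S" for n using r that by (simp add: b_def)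
  have z: "fourier_coeff (\<lambda>t. 0) n = 0" for n by (simp add: fourier_coeff_def)
  have "integral {0..1} (\<lambda>t. (cmod (0 - (\<Sum>m\<in>r ` S. b m * cis (2 * pi * of_int m * t))))\<^sup>2)
     = (\<Sum>m\<in>r ` S. (cmod (b m))\<^sup>2)"
    using integral_cmod_diff_trig_poly[of "\<lambda>t. 0" "r ` S" b] S by (simp add: z)
  then show ?thesis
    by (simp add: sum.reindex[OF r] b sum_negf cong: sum.cong)
qed

section \<open>The Zak transform of the spectrum of the window\<close>

text \<open>
  For \<open>cmod z = 1\<close> and \<open>0 \<le> s \<le> 1\<close> this is the Zak transform \<open>\<Sum>j. exp (- 4 * pi * k * |s + j|) * z^j\<close>
  over all integers \<open>j\<close>: the first summand is the geometric series over \<open>j \<ge> 0\<close>, the second one that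
  over \<open>j < 0\<close>. In this form continuity and the Fourier coefficients are read off without convergence arguments.
\<close>

definition exp_zak :: "real \<Rightarrow> complex \<Rightarrow> real \<Rightarrow> complex" where
  "exp_zak k z s = of_real (exp (- (4 * pi * k * s))) / (1 - of_real (exp (- (4 * pi * k))) * z)
     + of_real (exp (- (4 * pi * k * (1 - s)))) * cnj z / (1 - of_real (exp (- (4 * pi * k))) * cnj z)"

text \<open>
  The Zak transform of \<open>q * (1 - q)^2 = q - 2 * q^2 + q^3\<close> with \<open>q = exp (- 4 * pi * |s|)\<close>. Up to a
  constant, \<open>q * (1 - q)^2\<close> is the Fourier transform of the window at the frequency \<open>2 * s\<close>.
\<close>

definition gabor_symbol :: "complex \<Rightarrow> real \<Rightarrow> complex" where
  "gabor_symbol z s = exp_zak 1 z s - 2 * exp_zak 2 z s + exp_zak 3 z s"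

lemma one_minus_mult_unit_neq_0:
  assumes "cmod z = 1" "0 \<le> r" "r < (1::real)" shows "1 - of_real r * z \<noteq> 0"
proof
  assume "1 - of_real r * z = 0"
  then have "cmod (of_real r * z) = 1" by (metis eq_iff_diff_eq_0 norm_one)
  then show False using assms by (simp add: norm_mult)
qed

lemma continuous_on_exp_zak [continuous_intros]:
  assumes "k > 0" and z: "continuous_on S z" "\<And>x. x \<in> S \<Longrightarrow> cmod (z x) = 1" and s: "continuous_on S s"
  shows "continuous_on S (\<lambda>x. exp_zak k (z x) (s x))"
proof -
  have "exp (- (4 * pi * k)) < 1" using assms by simp
  then have "1 - of_real (exp (- (4 * pi * k))) * z x \<noteq> 0" "1 - of_real (exp (- (4 * pi * k))) * cnj (z x) \<noteq> 0"
    if "x \<in> S" for x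
    using one_minus_mult_unit_neq_0[of "z x" "exp (- (4 * pi * k))"] 
      one_minus_mult_unit_neq_0[of "cnj (z x)" "exp (- (4 * pi * k))"] z that by auto
  then show ?thesis unfolding exp_zak_def
    by (intro continuous_intros z s) auto
qed

lemma continuous_on_gabor_symbol [continuous_intros]:
  assumes z: "continuous_on S z" "\<And>x. x \<in> S \<Longrightarrow> cmod (z x) = 1" and s: "continuous_on S s"
  shows "continuous_on S (\<lambda>x. gabor_symbol (z x) (s x))"
  unfolding gabor_symbol_def by (intro continuous_intros z s) auto

text \<open>
  The function \<open>exp (- 4 * pi * k * |s|)\<close> is even, so that the substitution \<open>j \<mapsto> - 1 - j\<close> in the series
  exchanges \<open>s\<close> and \<open>1 - s\<close>, up to a factor of modulus 1.
\<close>

lemma exp_zak_reflect: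
  assumes z: "cmod z = 1"
  shows "exp_zak k z (1 - s) = cnj z * cnj (exp_zak k z s)"
proof -
  have "cnj z * z = 1" using z by (metis complex_norm_square mult.commute of_real_1 power_one)
  then show ?thesis
    unfolding exp_zak_def by (simp add: algebra_simps)
qed

lemma cmod_gabor_symbol_reflect:
  assumes z: "cmod z = 1"
  shows "cmod (gabor_symbol z (1 - s)) = cmod (gabor_symbol z s)"
proof -
  have "gabor_symbol z (1 - s) = cnj z * cnj (gabor_symbol z s)"
    unfolding gabor_symbol_def exp_zak_reflect[OF z] by (simp add: algebra_simps)
  then show ?thesis using z by (simp add: norm_mult)
qed

text \<open>
  The shift \<open>j \<mapsto> j + 1\<close> in the series. It makes \<open>cis (4 * pi * x * s) * exp_zak k (cis (4 * pi * x)) s\<close>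
  take the same value at \<open>s = 0\<close> and \<open>s = 1\<close>, as Parseval's identity requires.
\<close>

lemma exp_zak_endpoints:
  assumes z: "cmod z = 1" and k: "k > 0"
  shows "z * exp_zak k z 1 = exp_zak k z 0"
proof -
  define r where "r = complex_of_real (exp (- (4 * pi * k)))"
  have zz: "cnj z * z = 1" using z by (metis complex_norm_square mult.commute of_real_1 power_one)
  have nz: "1 - r * z \<noteq> 0" "1 - r * cnj z \<noteq> 0"
    using one_minus_mult_unit_neq_0[of z "exp (- (4 * pi * k))"]
      one_minus_mult_unit_neq_0[of "cnj z" "exp (- (4 * pi * k))"] z k by (auto simp: r_def)
  have "z * exp_zak k z 1 = r * z / (1 - r * z) + (cnj z * z) / (1 - r * cnj z)"
    by (simp add: exp_zak_def r_def algebra_simps)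
  also have "\<dots> = (1 / (1 - r * z) - 1) + (1 + r * cnj z / (1 - r * cnj z))"
    using nz unfolding zz by (simp add: divide_simps)
  also have "\<dots> = exp_zak k z 0" by (simp add: exp_zak_def r_def)
  finally show ?thesis .
qed

text \<open>
  This is Poisson summation: the Fourier coefficients of the periodization of \<open>exp (- 4 * pi * k * |s|)\<close>,
  modulated by \<open>cis (4 * pi * x * s)\<close>, are values of its Fourier transform. In closed form both
  summands are exponentials in \<open>s\<close>, and the numerators from the integrals over the unit interval
  cancel the denominators of the geometric series.
\<close>

lemma fourier_coeff_exp_zak:
  assumes k: "k > 0"
  shows "fourier_coeff (\<lambda>s. cis (4 * pi * x * s) * exp_zak k (cis (4 * pi * x)) s) l
    = of_real (k / (2 * pi) / (k\<^sup>2 + (x - of_int l / 2)\<^sup>2))"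
proof -
  define r where "r = complex_of_real (exp (- (4 * pi * k)))"
  define z where "z = cis (4 * pi * x)"
  define a where "a = complex_of_real (4 * pi * k)"
  define b where "b = \<i> * of_real (2 * pi * (2 * x - of_int l))"
  have "cmod z = 1" by (simp add: z_def)
  then have zz: "cnj z * z = 1" by (metis complex_norm_square mult.commute of_real_1 power_one)
  have nz: "1 - r * z \<noteq> 0" "1 - r * cnj z \<noteq> 0"
    using one_minus_mult_unit_neq_0[of z "exp (- (4 * pi * k))"]
      one_minus_mult_unit_neq_0[of "cnj z" "exp (- (4 * pi * k))"] \<open>cmod z = 1\<close> k by (auto simp: r_def)
  have ab: "b - a \<noteq> 0" "b + a \<noteq> 0" using k by (auto simp: a_def b_def complex_eq_iff)
  have eb: "exp b = z"
  proof -
    have "exp b = cis (4 * pi * x - 2 * pi * of_int l)"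
      unfolding b_def cis_conv_exp by (simp add: algebra_simps)
    also have "\<dots> = z / cis (2 * pi * of_int l)" by (simp only: z_def cis_divide)
    finally show ?thesis by simp
  qed
  have ea: "exp (- a) = r" "exp a * r = 1"
  proof -
    show "exp (- a) = r" unfolding a_def r_def by (simp only: of_real_minus[symmetric] exp_of_real)
    then show "exp a * r = 1" by (metis exp_minus_inverse)
  qed
  have "((\<lambda>s. exp ((b - a) * of_real s) / (1 - r * z)
            + exp ((b + a) * of_real s) * (r * cnj z / (1 - r * cnj z))) has_integral
         (exp (b - a) - 1) / (b - a) / (1 - r * z) 
          + (exp (b + a) - 1) / (b + a) * (r * cnj z / (1 - r * cnj z))) {0..1}"
    by (intro has_integral_add has_integral_divide has_integral_mult_left has_integral_exp_unit_interval ab)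
  also have "(\<lambda>s. exp ((b - a) * of_real s) / (1 - r * z) + exp ((b + a) * of_real s) * (r * cnj z / (1 - r * cnj z)))
      = (\<lambda>s. cis (4 * pi * x * s) * exp_zak k z s * cis (- (2 * pi * of_int l * s)))"
  proof
    fix s :: real
    have c: "cis (4 * pi * x * s) * cis (- (2 * pi * of_int l * s)) = exp (b * of_real s)"
      by (subst cis_mult, unfold b_def cis_conv_exp) (simp add: algebra_simps)
    have 1: "exp ((b - a) * of_real s) = exp (b * of_real s) * of_real (exp (- (4 * pi * k * s)))"
      by (simp add: a_def left_diff_distrib exp_diff exp_minus divide_inverse exp_of_real[symmetric])
    have 2: "exp ((b + a) * of_real s) * r = exp (b * of_real s) * of_real (exp (- (4 * pi * k * (1 - s))))"
    proof -
      have "exp ((b + a) * of_real s) * r = exp (b * of_real s) * (exp (a * of_real s) * exp (- a))"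
        unfolding ea(1) distrib_right exp_add by (simp only: mult_ac)
      also have "exp (a * of_real s) * exp (- a) = of_real (exp (- (4 * pi * k * (1 - s))))"
        unfolding exp_add[symmetric] by (simp add: a_def exp_of_real[symmetric] algebra_simps)
      finally show ?thesis .
    qed
    have "exp ((b + a) * of_real s) * (r * cnj z / (1 - r * cnj z))
        = (exp ((b + a) * of_real s) * r) * (cnj z / (1 - r * cnj z))" by simp
    then show "exp ((b - a) * of_real s) / (1 - r * z) + exp ((b + a) * of_real s) * (r * cnj z / (1 - r * cnj z))
      = cis (4 * pi * x * s) * exp_zak k z s * cis (- (2 * pi * of_int l * s))"
      unfolding 1 2 exp_zak_def c[symmetric] r_def[symmetric] by (simp add: algebra_simps add_divide_distrib)
  qed
  also have "(exp (b - a) - 1) / (b - a) / (1 - r * z) + (exp (b + a) - 1) / (b + a) * (r * cnj z / (1 - r * cnj z))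
     = 1 / (a - b) + 1 / (a + b)"
  proof -
    have "exp (b - a) = r * z" using eb ea by (simp add: exp_diff exp_minus divide_inverse mult.commute)
    then have 1: "(exp (b - a) - 1) / (b - a) / (1 - r * z) = 1 / (a - b)"
      using nz ab by (simp add: divide_simps) (simp add: algebra_simps)
    have "exp (b + a) * (r * cnj z) = (exp a * r) * (cnj z * z)" using eb by (simp add: exp_add mult_ac)
    then have "(exp (b + a) - 1) * (r * cnj z) = 1 - r * cnj z" unfolding ea zz by (simp add: algebra_simps)
    then have "(exp (b + a) - 1) / (b + a) * (r * cnj z / (1 - r * cnj z)) = 1 / (a + b)"
      using nz by (simp add: add.commute)
    with 1 show ?thesis by simp
  qed
  also have "\<dots> = 2 * a / (a\<^sup>2 - b\<^sup>2)"
  proof -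
    have "a - b \<noteq> 0" "a + b \<noteq> 0" using ab by (auto simp: add.commute)
    moreover have "a\<^sup>2 - b\<^sup>2 = (a - b) * (a + b)" by (simp add: power2_eq_square algebra_simps)
    ultimately show ?thesis by (simp add: divide_simps)
  qed
  also have "\<dots> = of_real (2 * (4 * pi * k) / ((4 * pi * k)\<^sup>2 + (2 * pi * (2 * x - of_int l))\<^sup>2))"
    unfolding a_def b_def by (simp add: power_mult_distrib)
  also have "2 * (4 * pi * k) / ((4 * pi * k)\<^sup>2 + (2 * pi * (2 * x - of_int l))\<^sup>2)
      = k / (2 * pi) / (k\<^sup>2 + (x - of_int l / 2)\<^sup>2)"
  proof -
    have "(4 * pi * k)\<^sup>2 + (2 * pi * (2 * x - of_int l))\<^sup>2 = 16 * pi\<^sup>2 * (k\<^sup>2 + (x - of_int l / 2)\<^sup>2)"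
      by (simp add: power2_eq_square algebra_simps)
    moreover have "k\<^sup>2 + (x - of_int l / 2)\<^sup>2 > 0" using k by (simp add: add_pos_nonneg)
    ultimately show ?thesis by (simp add: divide_simps power2_eq_square)
  qed
  finally show ?thesis unfolding fourier_coeff_def z_def by (rule integral_unique)
qed

text \<open>
  The two denominators are complex conjugates of each other and thus have the same modulus, which
  makes the sign of the imaginary part visible.
\<close>

lemma Im_zak_term:
  fixes a b r :: real
  assumes z: "cmod z = 1"
  shows "Im (of_real a / (1 - of_real r * z) + of_real b * cnj z / (1 - of_real r * cnj z))
      = - Im z * (b - a * r) / (cmod (1 - of_real r * z))\<^sup>2"
proof -
  have zz: "z * cnj z = 1" using z by (metis complex_norm_square of_real_1 power_one)
  have c: "1 - of_real r * cnj z = cnj (1 - of_real r * z)" by simp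
  have "of_real a / (1 - of_real r * z) + of_real b * cnj z / (1 - of_real r * cnj z)
      = (of_real a * cnj (1 - of_real r * z) + of_real b * (cnj z - of_real r * (z * cnj z))) / of_real ((cmod (1 - of_real r * z))\<^sup>2)"
    unfolding c complex_div_cnj[of "of_real a"] complex_div_cnj[of "of_real b * cnj z"] complex_mod_cnj
    by (simp add: add_divide_distrib diff_divide_distrib algebra_simps)
  then show ?thesis unfolding zz by (simp only: Im_divide_of_real) (simp add: algebra_simps)
qed

text \<open>
  In the symbol, \<open>q = exp (- 4 * pi * s)\<close> and \<open>p = exp (- 4 * pi * (1 - s))\<close>, so that \<open>p \<le> q\<close> means
  \<open>s \<le> 1/2\<close>. Since \<open>q\<close> is small, in the imaginary part and in the values at \<open>z = 1\<close> and \<open>z = - 1\<close> the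
  first of the three terms dominates the second, and the third one has the sign of the first. At
  \<open>z = - 1\<close> the three terms are multiples of \<open>q - p\<close>, hence the exceptional case \<open>p = q\<close>.
\<close>

lemma zak_combination_zero_imp:
  fixes p q :: real
  assumes p: "0 < p" "p \<le> q" "q \<le> 1/8" and z: "cmod z = 1"
    and zero: "(of_real q / (1 - of_real (p * q) * z) + of_real p * cnj z / (1 - of_real (p * q) * cnj z))
      - 2 * (of_real (q^2) / (1 - of_real ((p * q)^2) * z) + of_real (p^2) * cnj z / (1 - of_real ((p * q)^2) * cnj z))
      + (of_real (q^3) / (1 - of_real ((p * q)^3) * z) + of_real (p^3) * cnj z / (1 - of_real ((p * q)^3) * cnj z)) = 0"
  shows "z = - 1 \<and> p = q"
proof -
  have pq: "0 < p * q" "p * q \<le> 1/64" using p mult_mono[of p "1/8" q "1/8"] by auto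
  have le1: "x ^ n \<le> 1" if "0 \<le> x" "x \<le> 1" for x :: real and n using power_le_one[OF that] .
  have pq2: "0 < (p * q)^2" "(p * q)^2 \<le> 1/64" using pq mult_mono[of "p*q" "1/64" "p*q" 1] by (auto simp: power2_eq_square)
  define D where "D n = (cmod (1 - of_real ((p * q)^n) * z))\<^sup>2" for n :: nat
  have bnd: "63/64 \<le> cmod (1 - of_real r * z) \<and> cmod (1 - of_real r * z) \<le> 65/64" if "0 < r" "r \<le> 1/64" for r
  proof -
    have "cmod (of_real r * z) \<le> 1/64" using that z by (simp add: norm_mult)
    then show ?thesis
      using norm_triangle_ineq2[of 1 "of_real r * z"] norm_triangle_ineq4[of 1 "of_real r * z"] by simp
  qed
  have D1: "0 < D 1" "D 1 \<le> (65/64)^2" and D2: "(63/64)^2 \<le> D 2"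
    using bnd[OF pq] bnd[OF pq2] power_mono[of "63/64" "cmod (1 - of_real ((p * q)^2) * z)" 2]
      power_mono[of "cmod (1 - of_real (p * q) * z)" "65/64" 2]
    by (auto simp: D_def)
  have D3: "0 \<le> D 3" by (simp add: D_def)
  have Im_lin: "Im u - 2 * Im v + Im w = 0" if "u - 2 * v + w = 0" for u v w
    using arg_cong[OF that, of Im] by simp
  have "0 = - Im z * (p - q * (p * q)) / D 1 - 2 * (- Im z * (p^2 - q^2 * (p * q)^2) / D 2)
      + (- Im z * (p^3 - q^3 * (p * q)^3) / D 3)"
    using Im_lin[OF zero]
    unfolding Im_zak_term[OF z, of q "p * q" p] Im_zak_term[OF z, of "q^2" "(p * q)^2" "p^2"]
      Im_zak_term[OF z, of "q^3" "(p * q)^3" "p^3"] D_def power_one_right by simp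
  also have "\<dots> = - Im z * ((p - q * (p * q)) / D 1 - 2 * ((p^2 - q^2 * (p * q)^2) / D 2) + (p^3 - q^3 * (p * q)^3) / D 3)"
    by (simp add: algebra_simps)
  finally have "Im z * ((p - q * (p * q)) / D 1 - 2 * ((p^2 - q^2 * (p * q)^2) / D 2) + (p^3 - q^3 * (p * q)^3) / D 3) = 0"
    by simp
  moreover have "(p - q * (p * q)) / D 1 - 2 * ((p^2 - q^2 * (p * q)^2) / D 2) + (p^3 - q^3 * (p * q)^3) / D 3 > 0"
  proof -
    have qq: "q * q \<le> 1/64" using p mult_mono[of q "1/8" q "1/8"] by auto
    have "q^3 * (p * q)^3 = p^3 * (q^6)" by (simp add: power_mult_distrib flip: power_add)
    also have "\<dots> \<le> p^3 * 1" using p le1 by (intro mult_left_mono) auto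
    finally have 3: "0 \<le> (p^3 - q^3 * (p * q)^3) / D 3" using D3 by simp
    have "p * (63/64) / (65/64)^2 \<le> (p - q * (p * q)) / D 1"
    proof (rule frac_le)
      have "p * (q * q) \<le> p * (1/64)" using p qq by (intro mult_left_mono) auto
      then show "p * (63/64) \<le> p - q * (p * q)" by (simp add: algebra_simps)
    qed (use D1 p qq in \<open>auto simp: mult_le_cancel_left1\<close>)
    moreover have "(p^2 - q^2 * (p * q)^2) / D 2 \<le> (p * (1/8)) / (63/64)^2"
    proof (rule frac_le)
      have "p * p \<le> p * (1/8)" using p by (intro mult_left_mono) auto
      moreover have "0 \<le> q^2 * (p * q)^2" by simp
      ultimately show "p^2 - q^2 * (p * q)^2 \<le> p * (1/8)" unfolding power2_eq_square[of p] by linarith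
    qed (use D2 p in auto)
    moreover have "p * (9/10) \<le> p * (63/64) / (65/64)^2" "(p * (1/8)) / (63/64)^2 \<le> p * (1/7)"
      using p(1) by (simp_all add: power2_eq_square)
    ultimately show ?thesis using 3 p(1) by linarith
  qed
  ultimately have "Im z = 0" by simp
  then have "z = 1 \<or> z = - 1"
    using z by (auto simp: complex_eq_iff cmod_def)
  have u: "0 < p + q" "p + q \<le> 1/4" using p by auto
  have d2: "0 < 1 - (p * q)^2" "1 - (p * q)^2 \<ge> 63/64" and d3: "0 < 1 - (p * q)^3"
    using pq2 pq power_less_one_iff[of "p*q" 3] by auto
  from \<open>z = 1 \<or> z = -1\<close> show ?thesis
  proof
    assume "z = 1"
    from zero have "complex_of_real ((q + p) / (1 - p * q) - 2 * ((q^2 + p^2) / (1 - (p*q)^2)) + (q^3 + p^3) / (1 - (p*q)^3)) = 0"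
      unfolding \<open>z = 1\<close> by (simp add: add_divide_distrib)
    then have "(q + p) / (1 - p * q) - 2 * ((q^2 + p^2) / (1 - (p*q)^2)) + (q^3 + p^3) / (1 - (p*q)^3) = 0"
      by (simp only: of_real_eq_0_iff)
    moreover have "(q^3 + p^3) / (1 - (p*q)^3) > 0" using p d3 by (auto intro!: divide_pos_pos add_pos_pos)
    moreover have "(q + p) \<le> (q + p) / (1 - p * q)" using p pq by (simp add: field_simps)
    moreover have "(q^2 + p^2) / (1 - (p*q)^2) \<le> ((p + q) * (1/4)) / (63/64)"
    proof (rule frac_le)
      have "q^2 + p^2 \<le> (p + q) * (p + q)" using p by (simp add: power2_eq_square algebra_simps)
      also have "\<dots> \<le> (p + q) * (1/4)" using u by (intro mult_left_mono) auto
      finally show "q^2 + p^2 \<le> (p + q) * (1/4)" .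
    qed (use u d2 in auto)
    moreover have False if "X - 2 * Y + W = 0" "W > 0" "v \<le> X" "Y \<le> v * (1/4) / (63/64)" "v > 0"
      for X Y W v :: real using that by simp
    ultimately have False using u unfolding add.commute[of q p] by blast
    then show ?thesis ..
  next
    assume "z = - 1"
    from zero have "complex_of_real ((q - p) / (1 + p * q) - 2 * ((q^2 - p^2) / (1 + (p*q)^2)) + (q^3 - p^3) / (1 + (p*q)^3)) = 0"
      unfolding \<open>z = -1\<close> by (simp add: diff_divide_distrib)
    then have e: "(q - p) / (1 + p * q) - 2 * ((q^2 - p^2) / (1 + (p*q)^2)) + (q^3 - p^3) / (1 + (p*q)^3) = 0"
      by (simp only: of_real_eq_0_iff)
    have "p^3 \<le> q^3" using p by (intro power_mono) auto
    then have "(q^3 - p^3) / (1 + (p*q)^3) \<ge> 0" using pq by (auto intro!: divide_nonneg_nonneg)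
    moreover have "(q - p) * (64/65) \<le> (q - p) / (1 + p * q)"
    proof -
      have "(q - p) / (65/64) \<le> (q - p) / (1 + p * q)" using p pq by (intro frac_le) linarith+
      then show ?thesis by simp
    qed
    moreover have "(q^2 - p^2) / (1 + (p*q)^2) \<le> ((q - p) * (1/4)) / 1"
    proof (rule frac_le)
      have "q^2 - p^2 = (q - p) * (p + q)" by (simp add: power2_eq_square algebra_simps)
      also have "\<dots> \<le> (q - p) * (1/4)" using u p by (intro mult_left_mono) auto
      finally show "q^2 - p^2 \<le> (q - p) * (1/4)" .
    qed (use p pq in auto)
    moreover have "v \<le> 0" if "X - 2 * Y + W = 0" "W \<ge> 0" "v * (64/65) \<le> X" "Y \<le> v * (1/4) / 1"
      for X Y W v :: real using that by simp
    ultimately have "q - p \<le> 0" using e by blast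
    then show ?thesis using p \<open>z = -1\<close> by simp
  qed
qed

lemma exp_pi_ge: "exp pi \<ge> 8"
proof -
  have "(5/2::real) \<le> exp 1" using exp_lower_Taylor_quadratic[of 1] by simp
  then have "(5/2::real)^3 \<le> exp 1 ^ 3" by (intro power_mono) auto
  also have "\<dots> = exp (3::real)" by (simp flip: exp_of_nat_mult)
  also have "\<dots> \<le> exp pi" using pi_gt3 by simp
  finally show ?thesis by (simp add: power3_eq_cube)
qed

lemma gabor_symbol_zero_imp:
  assumes z: "cmod z = 1" and s: "1/4 \<le> s" "s \<le> 1/2" and zero: "gabor_symbol z s = 0"
  shows "z = - 1 \<and> s = 1/2"
proof -
  \<comment> \<open>The product \<open>p * q\<close> is \<open>exp (- 4 * pi)\<close>, the ratio of the geometric series.\<close>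
  define q where "q = exp (- (4 * pi * s))"
  define p where "p = exp (- (4 * pi * (1 - s)))"
  have "pi * 1 \<le> pi * (4 * s)" using s by (intro mult_left_mono) auto
  then have "q \<le> exp (- pi)" by (simp add: q_def algebra_simps)
  also have "\<dots> \<le> 1/8" using exp_pi_ge by (simp add: exp_minus field_simps)
  finally have q: "q \<le> 1/8" .
  have pq: "0 < p" "p \<le> q" using s by (auto simp: p_def q_def)
  have ppq: "p * q = exp (- (4 * pi))" by (simp add: p_def q_def algebra_simps flip: exp_add)
  have e: "exp (- (4 * pi * real n * s)) = q ^ n" "exp (- (4 * pi * real n * (1 - s))) = p ^ n"
    "exp (- (4 * pi * real n)) = (p * q) ^ n" for n
    unfolding ppq unfolding p_def q_def by (simp_all add: exp_of_nat_mult[symmetric] mult_ac)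
  have "z = - 1 \<and> p = q"
    using zak_combination_zero_imp[OF pq q z] zero e[of 1] e[of 2] e[of 3]
    by (simp add: gabor_symbol_def exp_zak_def del: of_real_power of_real_mult)
  then show ?thesis using s by (auto simp: p_def q_def)
qed

text \<open>
  The series at \<open>s = 0\<close> has the terms \<open>\<psi>(j) * (- 1)^j\<close>, where \<open>\<psi>(s) = q * (1 - q)^2\<close> and
  \<open>q = exp (- 4 * pi * |s|)\<close>, so that \<open>\<psi>(0) = 0\<close>. Its value is negative, because
  the terms with \<open>j = 1\<close> and \<open>j = - 1\<close> dominate.
\<close>

lemma gabor_symbol_minus_one_nonzero: "gabor_symbol (- 1) 0 \<noteq> 0"
proof
  define r where "r = exp (- (4 * pi))"
  have "exp pi \<le> exp (4 * pi)" by simp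
  then have "8 \<le> exp (4 * pi)" using exp_pi_ge by linarith
  then have r: "0 < r" "r \<le> 1/8" by (auto simp: r_def exp_minus divide_simps)
  have e: "exp (- (4 * pi * real n)) = r ^ n" for n
    unfolding r_def by (simp add: exp_of_nat_mult[symmetric] mult_ac)
  assume "gabor_symbol (- 1) 0 = 0"
  then have "complex_of_real ((1 - r) / (1 + r) - 2 * ((1 - r^2) / (1 + r^2)) + (1 - r^3) / (1 + r^3)) = 0"
    using e[of 1] e[of 2] e[of 3] by (simp add: gabor_symbol_def exp_zak_def diff_divide_distrib)
  then have "(1 - r) / (1 + r) - 2 * ((1 - r^2) / (1 + r^2)) + (1 - r^3) / (1 + r^3) = 0"
    by (simp only: of_real_eq_0_iff)
  moreover have "(1 - r^3) / (1 + r^3) \<le> 1"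
  proof -
    have "0 < r^3" using r by simp
    then have "0 < 1 + r^3" "1 - r^3 \<le> 1 * (1 + r^3)" using r by (auto intro!: add_pos_pos)
    then show ?thesis by (simp only: pos_divide_le_eq)
  qed
  moreover have "(1 - r) / (1 + r) = 1 - 2 * r / (1 + r)" using r by (simp add: field_simps)
  moreover have "(1 - r^2) / (1 + r^2) = 1 - 2 * r^2 / (1 + r^2)" using r add_pos_pos[of 1 "r^2"] by (simp add: field_simps)
  moreover have "r / (9/8) \<le> r / (1 + r)" using r by (intro frac_le) auto
  moreover have "r^2 / (1 + r^2) \<le> (r * (1/8)) / 1"
    using r by (intro frac_le) (auto simp: power2_eq_square intro!: mult_left_mono)
  ultimately show False using r by simp
qed

text \<open>
  After the reflection \<open>s + 1/2 \<mapsto> 1/2 - s\<close> the two arguments add up to \<open>1/2\<close>, so that the larger one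
  is at least \<open>1/4\<close>, where \<open>gabor_symbol_zero_imp\<close> describes the zeros.
\<close>

lemma gabor_symbol_no_common_zero:
  assumes z: "cmod z = 1" and s: "0 \<le> s" "s \<le> 1/2"
  shows "gabor_symbol z s \<noteq> 0 \<or> gabor_symbol z (s + 1/2) \<noteq> 0"
proof (rule ccontr)
  assume "\<not> ?thesis"
  then have 0: "gabor_symbol z s = 0" "gabor_symbol z (1/2 - s) = 0"
    using cmod_gabor_symbol_reflect[OF z, of "s + 1/2"] by auto
  \<comment> \<open>The condition is symmetric under the exchange of \<open>s\<close> and \<open>1/2 - s\<close>.\<close>
  define t where "t = max s (1/2 - s)"
  have t: "1/4 \<le> t" "t \<le> 1/2" "gabor_symbol z t = 0" "gabor_symbol z (1/2 - t) = 0"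
    using s 0 by (auto simp: t_def max_def)
  from gabor_symbol_zero_imp[OF z t(1-3)] have "z = - 1" "t = 1/2" by auto
  with t(4) gabor_symbol_minus_one_nonzero show False by simp
qed

lemma gabor_symbol_bounds:
  obtains a b where "a > 0" "b > 0"
    "\<And>z s. cmod z = 1 \<Longrightarrow> s \<in> {0..1/2} \<Longrightarrow> a \<le> (cmod (gabor_symbol z s))\<^sup>2 + (cmod (gabor_symbol z (s + 1/2)))\<^sup>2"
    "\<And>z s. cmod z = 1 \<Longrightarrow> s \<in> {0..1/2} \<Longrightarrow> (cmod (gabor_symbol z s))\<^sup>2 + (cmod (gabor_symbol z (s + 1/2)))\<^sup>2 \<le> b"
proof -
  define \<phi> where "\<phi> x = (cmod (gabor_symbol (fst x) (snd x)))\<^sup>2 + (cmod (gabor_symbol (fst x) (snd x + 1/2)))\<^sup>2" for x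
  let ?X = "sphere 0 1 \<times> {0..1/2} :: (complex \<times> real) set"
  have c: "continuous_on ?X \<phi>" unfolding \<phi>_def by (intro continuous_intros) auto
  have X: "compact ?X" "?X \<noteq> {}" by (auto intro!: compact_Times)
  obtain m where m: "m \<in> ?X" "\<And>x. x \<in> ?X \<Longrightarrow> \<phi> m \<le> \<phi> x"
    using continuous_attains_inf[OF X c] by blast
  obtain M where M: "M \<in> ?X" "\<And>x. x \<in> ?X \<Longrightarrow> \<phi> x \<le> \<phi> M"
    using continuous_attains_sup[OF X c] by blast
  have "\<phi> m > 0"
    using gabor_symbol_no_common_zero[of "fst m" "snd m"] m(1)
    by (auto simp: \<phi>_def add_pos_nonneg add_nonneg_pos)
  moreover have "\<phi> M > 0" using \<open>\<phi> m > 0\<close> m(2)[OF M(1)] by simp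
  ultimately show thesis
    using that[of "\<phi> m" "\<phi> M"] m(2) M(2) unfolding \<phi>_def by (force simp: \<phi>_def)
qed

section \<open>Frame inequalities on a dense subset\<close>

lemma L2_functionsD:
  assumes "f \<in> L2_functions"
  shows "f \<in> borel_measurable lebesgue" "integrable lebesgue (\<lambda>x. (cmod (f x))\<^sup>2)"
  using assms by (auto simp: L2_functions_def)

lemma L2_norm_power2: "(L2_norm f)\<^sup>2 = (LINT x|lebesgue. (cmod (f x))\<^sup>2)"
  unfolding L2_norm_def by (rule real_sqrt_pow2) simp

lemma cmod_diff_power2_le: "(cmod (a - b))\<^sup>2 \<le> 2 * (cmod a)\<^sup>2 + 2 * (cmod b)\<^sup>2"
proof -
  have "(cmod (a - b))\<^sup>2 \<le> (cmod a + cmod b)\<^sup>2"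
    by (intro power_mono norm_triangle_ineq4) simp
  also have "\<dots> \<le> 2 * (cmod a)\<^sup>2 + 2 * (cmod b)\<^sup>2"
    using zero_le_power2[of "cmod a - cmod b"] by (simp add: power2_eq_square algebra_simps)
  finally show ?thesis .
qed

lemma L2_functions_diff:
  assumes "f \<in> L2_functions" "h \<in> L2_functions"
  shows "(\<lambda>x. f x - h x) \<in> L2_functions"
proof -
  note [measurable] = assms[THEN L2_functionsD(1)]
  have "integrable lebesgue (\<lambda>x. (cmod (f x - h x))\<^sup>2)"
  proof (rule Bochner_Integration.integrable_bound)
    show "integrable lebesgue (\<lambda>x. 2 * (cmod (f x))\<^sup>2 + 2 * (cmod (h x))\<^sup>2)"
      using assms[THEN L2_functionsD(2)] by simp
  qed (auto simp: cmod_diff_power2_le)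
  then show ?thesis by (simp add: L2_functions_def)
qed

lemma L2_norm_diff_power2_le:
  assumes "f \<in> L2_functions" "h \<in> L2_functions"
  shows "(L2_norm (\<lambda>x. f x - h x))\<^sup>2 \<le> 2 * (L2_norm f)\<^sup>2 + 2 * (L2_norm h)\<^sup>2"
proof -
  note i = assms[THEN L2_functionsD(2)]
  have "(L2_norm (\<lambda>x. f x - h x))\<^sup>2 \<le> (LINT x|lebesgue. 2 * (cmod (f x))\<^sup>2 + 2 * (cmod (h x))\<^sup>2)"
    unfolding L2_norm_power2
    by (rule integral_mono) (use i L2_functionsD(2)[OF L2_functions_diff[OF assms]] in \<open>auto simp: cmod_diff_power2_le\<close>)
  also have "\<dots> = 2 * (L2_norm f)\<^sup>2 + 2 * (L2_norm h)\<^sup>2"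
    using i by (simp add: L2_norm_power2)
  finally show ?thesis .
qed

lemma L2_inner_integrable:
  assumes "f \<in> L2_functions" "h \<in> L2_functions"
  shows "integrable lebesgue (\<lambda>x. f x * cnj (h x))"
proof (rule Bochner_Integration.integrable_bound)
  note [measurable] = assms[THEN L2_functionsD(1)]
  show "integrable lebesgue (\<lambda>x. (cmod (f x))\<^sup>2 + (cmod (h x))\<^sup>2)"
    using assms[THEN L2_functionsD(2)] by simp
  have [measurable]: "(\<lambda>x. cnj (h x)) \<in> borel_measurable lebesgue"
    by (rule borel_measurable_continuous_on[of cnj]) (auto intro: continuous_intros)
  show "(\<lambda>x. f x * cnj (h x)) \<in> borel_measurable lebesgue" by measurable
  have "a * b \<le> a\<^sup>2 + b\<^sup>2" if "0 \<le> a" "0 \<le> b" for a b :: real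
    using zero_le_power2[of "a - b"] mult_nonneg_nonneg[OF that] unfolding power2_diff by linarith
  then show "AE x in lebesgue. norm (f x * cnj (h x)) \<le> norm ((cmod (f x))\<^sup>2 + (cmod (h x))\<^sup>2)"
    by (auto simp: norm_mult)
qed

lemma L2_inner_diff:
  assumes "f \<in> L2_functions" "u \<in> L2_functions" "h \<in> L2_functions"
  shows "L2_inner (\<lambda>x. f x - u x) h = L2_inner f h - L2_inner u h"
  unfolding L2_inner_def left_diff_distrib
  by (rule Bochner_Integration.integral_diff; rule L2_inner_integrable) (use assms in auto)

lemma L2_inner_Cauchy_Schwarz:
  assumes f: "f \<in> L2_functions" and h: "h \<in> L2_functions"
  shows "(cmod (L2_inner f h))\<^sup>2 \<le> (L2_norm f)\<^sup>2 * (L2_norm h)\<^sup>2"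
proof -
  note [measurable] = f[THEN L2_functionsD(1)] h[THEN L2_functionsD(1)]
  define c where "c = (LINT x|lebesgue. cmod (f x) * cmod (h x))"
  have i: "integrable lebesgue (\<lambda>x. cmod (f x) * cmod (h x))"
    using integrable_norm[OF L2_inner_integrable[OF f h]] by (simp add: norm_mult)
  have "cmod (L2_inner f h) \<le> c"
    unfolding L2_inner_def c_def using integral_norm_bound[of lebesgue "\<lambda>x. f x * cnj (h x)"]
    by (simp add: norm_mult)
  then have "(cmod (L2_inner f h))\<^sup>2 \<le> c\<^sup>2" by (intro power_mono) auto
  also have "ennreal (c\<^sup>2) \<le> ennreal ((L2_norm f)\<^sup>2 * (L2_norm h)\<^sup>2)"
  proof -
    have "c \<ge> 0" by (simp add: c_def)
    then have "ennreal (c\<^sup>2) = (\<integral>\<^sup>+x. ennreal (cmod (f x)) * ennreal (cmod (h x)) \<partial>lebesgue)\<^sup>2"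
      using nn_integral_eq_integral[OF i] by (simp add: c_def ennreal_power ennreal_mult)
    also have "\<dots> \<le> (\<integral>\<^sup>+x. (ennreal (cmod (f x)))\<^sup>2 \<partial>lebesgue) * (\<integral>\<^sup>+x. (ennreal (cmod (h x)))\<^sup>2 \<partial>lebesgue)"
      by (rule Cauchy_Schwarz_nn_integral) auto
    also have "\<dots> = ennreal ((L2_norm f)\<^sup>2 * (L2_norm h)\<^sup>2)"
      using nn_integral_eq_integral[OF L2_functionsD(2)[OF f]] nn_integral_eq_integral[OF L2_functionsD(2)[OF h]]
      by (simp add: L2_norm_power2 ennreal_power ennreal_mult)
    finally show ?thesis .
  qed
  then have "c\<^sup>2 \<le> (L2_norm f)\<^sup>2 * (L2_norm h)\<^sup>2" by (simp add: ennreal_le_iff)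
  finally show ?thesis .
qed

lemma sum_L2_inner_le:
  assumes f: "f \<in> L2_functions" and u: "u \<in> L2_functions" and h: "range h \<subseteq> L2_functions"
  shows "(\<Sum>i\<in>F. (cmod (L2_inner f (h i)))\<^sup>2)
    \<le> 2 * (\<Sum>i\<in>F. (cmod (L2_inner u (h i)))\<^sup>2) + 2 * (\<Sum>i\<in>F. (cmod (L2_inner (\<lambda>x. f x - u x) (h i)))\<^sup>2)"
proof -
  have "(cmod (L2_inner f (h i)))\<^sup>2 \<le> 2 * (cmod (L2_inner u (h i)))\<^sup>2 + 2 * (cmod (L2_inner (\<lambda>x. f x - u x) (h i)))\<^sup>2" for i
  proof -
    have "h i \<in> L2_functions" using h by auto
    then show ?thesis
      using cmod_diff_power2_le[of "L2_inner u (h i)" "- L2_inner (\<lambda>x. f x - u x) (h i)"]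
      by (simp add: L2_inner_diff f u norm_minus_commute)
  qed
  then show ?thesis unfolding sum_distrib_left sum.distrib[symmetric] by (intro sum_mono) auto
qed

text \<open>
  Both inequalities are carried over from \<open>D\<close> by \<open>|a|^2 \<le> 2 * |b|^2 + 2 * |a - b|^2\<close>, at the price of a
  factor 4 in the bounds. The upper bound comes first: for a finite part of the frame sum it follows
  from continuity of finitely many functionals. It then controls the frame sum of the approximation
  error, which yields the lower bound.
\<close>

lemma L2_frame_if_dense:
  fixes h :: "'i \<Rightarrow> real \<Rightarrow> complex"
  assumes h: "range h \<subseteq> L2_functions" and D: "D \<subseteq> L2_functions"
    and dense: "\<And>f e. f \<in> L2_functions \<Longrightarrow> e > 0 \<Longrightarrow> \<exists>u\<in>D. (L2_norm (\<lambda>x. f x - u x))\<^sup>2 < e"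
    and "A > 0" "B > 0"
    and upper: "\<And>u F. u \<in> D \<Longrightarrow> finite F \<Longrightarrow> (\<Sum>i\<in>F. (cmod (L2_inner u (h i)))\<^sup>2) \<le> B * (L2_norm u)\<^sup>2"
    and lower: "\<And>u. u \<in> D \<Longrightarrow> A * (L2_norm u)\<^sup>2 \<le> (\<Sum>\<^sub>\<infinity>i. (cmod (L2_inner u (h i)))\<^sup>2)"
  shows "L2_frame h"
proof -
  let ?S = "\<lambda>f i. (cmod (L2_inner f (h i)))\<^sup>2"
  have fin: "sum (?S f) F \<le> 4 * B * (L2_norm f)\<^sup>2" if f: "f \<in> L2_functions" and F: "finite F" for f F
  proof (rule field_le_epsilon)
    fix e :: real assume "e > 0"
    define C where "C = 4 * B + 2 * (\<Sum>i\<in>F. (L2_norm (h i))\<^sup>2)"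
    have C: "C > 0" using \<open>B > 0\<close> by (simp add: C_def add_pos_nonneg sum_nonneg)
    then obtain u where u: "u \<in> D" "(L2_norm (\<lambda>x. f x - u x))\<^sup>2 < e / C"
      using dense[OF f, of "e / C"] \<open>e > 0\<close> by auto
    let ?d = "\<lambda>x. f x - u x"
    have uL: "u \<in> L2_functions" using u D by auto
    have d: "?d \<in> L2_functions" using L2_functions_diff[OF f uL] .
    have "sum (?S ?d) F \<le> (\<Sum>i\<in>F. (L2_norm ?d)\<^sup>2 * (L2_norm (h i))\<^sup>2)"
      using L2_inner_Cauchy_Schwarz[OF d] h by (intro sum_mono) auto
    then have 1: "sum (?S ?d) F \<le> (L2_norm ?d)\<^sup>2 * (\<Sum>i\<in>F. (L2_norm (h i))\<^sup>2)"
      by (simp add: sum_distrib_left)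
    have "(L2_norm (\<lambda>x. f x - ?d x))\<^sup>2 \<le> 2 * (L2_norm f)\<^sup>2 + 2 * (L2_norm ?d)\<^sup>2"
      by (rule L2_norm_diff_power2_le[OF f d])
    then have "B * (L2_norm u)\<^sup>2 \<le> B * (2 * (L2_norm f)\<^sup>2 + 2 * (L2_norm ?d)\<^sup>2)"
      using \<open>B > 0\<close> by simp
    then have "sum (?S u) F \<le> B * (2 * (L2_norm f)\<^sup>2 + 2 * (L2_norm ?d)\<^sup>2)"
      using upper[OF u(1) F] by linarith
    then have "sum (?S f) F \<le> 2 * (B * (2 * (L2_norm f)\<^sup>2 + 2 * (L2_norm ?d)\<^sup>2))
        + 2 * ((L2_norm ?d)\<^sup>2 * (\<Sum>i\<in>F. (L2_norm (h i))\<^sup>2))"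
      using 1 sum_L2_inner_le[OF f uL h, of F] by linarith
    also have "\<dots> = 4 * B * (L2_norm f)\<^sup>2 + C * (L2_norm ?d)\<^sup>2"
      by (simp add: C_def algebra_simps)
    also have "C * (L2_norm ?d)\<^sup>2 \<le> e" using u(2) C by (simp add: field_simps)
    finally show "sum (?S f) F \<le> 4 * B * (L2_norm f)\<^sup>2 + e" by simp
  qed
  have sm: "?S f summable_on UNIV" if "f \<in> L2_functions" for f
    using fin[OF that] by (intro nonneg_bdd_above_summable_on bdd_aboveI2) auto
  have up: "infsum (?S f) UNIV \<le> 4 * B * (L2_norm f)\<^sup>2" if "f \<in> L2_functions" for f
    by (rule infsum_le_finite_sums[OF sm[OF that]]) (use fin[OF that] in auto)
  have lo: "A / 4 * (L2_norm f)\<^sup>2 \<le> infsum (?S f) UNIV" if f: "f \<in> L2_functions" for f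
  proof (rule field_le_epsilon)
    fix e :: real assume "e > 0"
    define C where "C = A / 2 + 4 * B"
    have C: "C > 0" using \<open>B > 0\<close> \<open>A > 0\<close> by (simp add: C_def)
    then obtain u where u: "u \<in> D" "(L2_norm (\<lambda>x. f x - u x))\<^sup>2 < e / C"
      using dense[OF f, of "e / C"] \<open>e > 0\<close> by auto
    let ?d = "\<lambda>x. f x - u x"
    have uL: "u \<in> L2_functions" using u D by auto
    have d: "?d \<in> L2_functions" using L2_functions_diff[OF f uL] .
    have dd: "(\<lambda>x. u x - f x) \<in> L2_functions" using L2_functions_diff[OF uL f] .
    have nd: "L2_norm (\<lambda>x. u x - f x) = L2_norm ?d"
      by (simp add: L2_norm_def norm_minus_commute)
    have "infsum (?S u) UNIV \<le> 2 * infsum (?S f) UNIV + 2 * (4 * B * (L2_norm ?d)\<^sup>2)"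
    proof (rule infsum_le_finite_sums[OF sm[OF uL]])
      fix F :: "'i set" assume F: "finite F"
      have "sum (?S f) F \<le> infsum (?S f) UNIV"
        by (rule finite_sum_le_infsum[OF sm[OF f] F]) auto
      then show "sum (?S u) F \<le> 2 * infsum (?S f) UNIV + 2 * (4 * B * (L2_norm ?d)\<^sup>2)"
        using sum_L2_inner_le[OF uL f h, of F] fin[OF dd F] unfolding nd by linarith
    qed
    moreover have "A * (L2_norm f)\<^sup>2 \<le> A * (2 * (L2_norm u)\<^sup>2 + 2 * (L2_norm ?d)\<^sup>2)"
      using L2_norm_diff_power2_le[OF uL dd] \<open>A > 0\<close> unfolding nd by simp
    then have "A * (L2_norm f)\<^sup>2 \<le> 2 * (A * (L2_norm u)\<^sup>2) + 2 * (A * (L2_norm ?d)\<^sup>2)"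
      by (simp add: algebra_simps)
    ultimately have "A * (L2_norm f)\<^sup>2 \<le> 4 * infsum (?S f) UNIV + 4 * (C * (L2_norm ?d)\<^sup>2)"
      using lower[OF u(1)] by (simp add: C_def algebra_simps)
    moreover have "C * (L2_norm ?d)\<^sup>2 \<le> e" using u(2) C by (simp add: field_simps)
    ultimately show "A / 4 * (L2_norm f)\<^sup>2 \<le> infsum (?S f) UNIV + e" by linarith
  qed
  show ?thesis
    unfolding L2_frame_def
  proof (rule conjI[OF h], rule exI[of _ "A / 4"], rule conjI, simp add: \<open>A > 0\<close>,
      rule exI[of _ "4 * B"], rule conjI, simp add: \<open>B > 0\<close>, intro ballI conjI)
  qed (use sm up lo in auto)
qed

text \<open>
  With a natural number as bound of the support, the integer translates of the unit interval that meet
  the support have an explicit range of indices.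
\<close>

definition compactly_supported_continuous :: "(real \<Rightarrow> complex) set" where
  "compactly_supported_continuous = {u. continuous_on UNIV u \<and> (\<exists>M::nat. \<forall>x. real M \<le> \<bar>x\<bar> \<longrightarrow> u x = 0)}"

lemma lebesgue_integral_compact_support:
  fixes v :: "real \<Rightarrow> 'b::euclidean_space"
  assumes v: "continuous_on UNIV v" and M: "\<And>x. M \<le> \<bar>x\<bar> \<Longrightarrow> v x = 0"
  shows "integrable lebesgue v" "(LINT x|lebesgue. v x) = integral {-M..M} v"
proof -
  have c: "continuous_on {-M..M} v" using v continuous_on_subset by blast
  have eq: "v = (\<lambda>x. indicator {-M..M} x *\<^sub>R v x)"
    using M by (auto simp: indicator_def fun_eq_iff)
  have "integrable lborel v"
    by (subst eq) (rule borel_integrable_compact[OF compact_Icc c])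
  moreover have "v \<in> borel_measurable lborel" using v borel_measurable_continuous_onI by simp
  ultimately show i: "integrable lebesgue v" by (simp add: integrable_completion)
  have "(LINT x|lebesgue. v x) = integral UNIV v" using integral_lebesgue[OF i] by simp
  also have "\<dots> = integral {-M..M} v"
  proof -
    have "v = (\<lambda>x. if x \<in> {-M..M} then v x else 0)" using M by (auto simp: fun_eq_iff)
    then show ?thesis by (metis integral_restrict_UNIV)
  qed
  finally show "(LINT x|lebesgue. v x) = integral {-M..M} v" .
qed

lemma compactly_supported_continuous_L2: "compactly_supported_continuous \<subseteq> L2_functions"
proof
  fix u assume "u \<in> compactly_supported_continuous"
  then obtain M where u: "continuous_on UNIV u" and M: "\<And>x. real M \<le> \<bar>x\<bar> \<Longrightarrow> u x = 0"
    by (auto simp: compactly_supported_continuous_def)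
  have "integrable lebesgue (\<lambda>x. (cmod (u x))\<^sup>2)"
    by (rule lebesgue_integral_compact_support[of _ "real M"]) (auto intro!: continuous_intros u simp: M)
  moreover have "u \<in> borel_measurable lebesgue"
    using u by (intro measurable_completion) (simp add: borel_measurable_continuous_onI)
  ultimately show "u \<in> L2_functions" by (simp add: L2_functions_def)
qed

lemma L2_truncation:
  assumes f: "f \<in> L2_functions" and e: "e > 0"
  shows "\<exists>n::nat. n > 0 \<and> (L2_norm (\<lambda>x. f x - (if \<bar>x\<bar> \<le> real n \<and> cmod (f x) \<le> real n then f x else 0)))\<^sup>2 < e"
proof -
  note [measurable] = f[THEN L2_functionsD(1)]
  have [measurable]: "(\<lambda>x::real. x) \<in> borel_measurable lebesgue" by (rule measurable_completion) simp
  define F where "F n x = (if \<bar>x\<bar> \<le> real n \<and> cmod (f x) \<le> real n then f x else 0)" for n x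
  have F [measurable]: "F n \<in> borel_measurable lebesgue" for n unfolding F_def by measurable
  have "(\<lambda>n. LINT x|lebesgue. (cmod (f x - F n x))\<^sup>2) \<longlonglongrightarrow> (LINT x::real|lebesgue. (0::real))"
  proof (rule integral_dominated_convergence)
    show "integrable lebesgue (\<lambda>x. (cmod (f x))\<^sup>2)" using f by (rule L2_functionsD)
    show "AE x in lebesgue. (\<lambda>n. (cmod (f x - F n x))\<^sup>2) \<longlonglongrightarrow> 0"
    proof (rule AE_I2)
      fix x
      obtain N :: nat where N: "max \<bar>x\<bar> (cmod (f x)) \<le> real N" using real_arch_simple by blast
      have "\<forall>\<^sub>F n in sequentially. (cmod (f x - F n x))\<^sup>2 = 0"
        using eventually_ge_at_top[of N] by eventually_elim (use N in \<open>auto simp: F_def\<close>)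
      then show "(\<lambda>n. (cmod (f x - F n x))\<^sup>2) \<longlonglongrightarrow> 0" by (rule tendsto_eventually)
    qed
    show "AE x in lebesgue. norm ((cmod (f x - F n x))\<^sup>2) \<le> (cmod (f x))\<^sup>2" for n
      by (auto simp: F_def)
  qed auto
  then have "\<forall>\<^sub>F n in sequentially. (LINT x|lebesgue. (cmod (f x - F n x))\<^sup>2) < e"
    using e by (intro order_tendstoD(2)) auto
  then have "\<forall>\<^sub>F n in sequentially. n > 0 \<and> (LINT x|lebesgue. (cmod (f x - F n x))\<^sup>2) < e"
    using eventually_gt_at_top[of 0] by eventually_elim auto
  then obtain n where "n > 0" "(LINT x|lebesgue. (cmod (f x - F n x))\<^sup>2) < e"
    by (auto dest: eventually_happens)
  then show ?thesis unfolding L2_norm_power2 F_def by blast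
qed

text \<open>
  A measurable function is an almost everywhere limit of continuous functions. Projecting these onto
  the ball in which \<open>f\<close> takes its values and multiplying them by a continuous cutoff function that is 1
  on the support of \<open>f\<close> preserves the limit and makes dominated convergence applicable.
\<close>

lemma bounded_L2_approx:
  assumes f [measurable]: "f \<in> borel_measurable lebesgue" and n: "n > (0::nat)"
    and bd: "\<And>x. cmod (f x) \<le> n" and supp: "\<And>x. real n < \<bar>x\<bar> \<Longrightarrow> f x = 0" and e: "e > 0"
  shows "\<exists>u\<in>compactly_supported_continuous. (L2_norm (\<lambda>x. f x - u x))\<^sup>2 < e"
proof -
  have "f measurable_on UNIV" using f by (intro lebesgue_measurable_imp_measurable_on) auto
  then obtain N g where N: "negligible N" and g: "\<And>k. continuous_on UNIV (g k)"
    and lim: "\<And>x. x \<notin> N \<Longrightarrow> (\<lambda>k. g k x) \<longlonglongrightarrow> f x"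
    unfolding measurable_on_def by auto
  define cl where "cl = closest_point (cball (0::complex) n)"
  have cl: "continuous_on UNIV cl" unfolding cl_def
    by (rule continuous_on_closest_point) auto
  have clb: "cmod (cl w) \<le> n" for w
    using closest_point_in_set[of "cball (0::complex) n" w] by (simp add: cl_def)
  have clf: "cl (f x) = f x" for x unfolding cl_def by (rule closest_point_self) (simp add: bd)
  \<comment> \<open>Equal to 1 on \<open>{- n..n}\<close> and to 0 outside of \<open>{- (n + 1)..n + 1}\<close>.\<close>
  define cut where "cut x = max 0 (min 1 (real n + 1 - \<bar>x\<bar>))" for x :: real
  have cut: "0 \<le> cut x" "cut x \<le> 1" for x by (auto simp: cut_def)
  define u where "u k x = of_real (cut x) * cl (g k x)" for k x
  have uc: "continuous_on UNIV (u k)" for k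
    unfolding u_def cut_def by (intro continuous_intros continuous_on_compose2[OF cl] g) auto
  have us: "u k x = 0" if "real (n + 1) \<le> \<bar>x\<bar>" for k x using that by (simp add: u_def cut_def)
  have ub: "cmod (u k x) \<le> n" for k x
  proof -
    have "cmod (u k x) \<le> 1 * real n" unfolding u_def norm_mult
      using cut[of x] clb by (intro mult_mono) auto
    then show ?thesis by simp
  qed
  have uD: "u k \<in> compactly_supported_continuous" for k
    unfolding compactly_supported_continuous_def using uc us by blast
  have [measurable]: "u k \<in> borel_measurable lebesgue" for k
    using uD compactly_supported_continuous_L2 L2_functionsD(1) by blast
  have "(\<lambda>k. LINT x|lebesgue. (cmod (f x - u k x))\<^sup>2) \<longlonglongrightarrow> (LINT x::real|lebesgue. (0::real))"
  proof (rule integral_dominated_convergence)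
    show "integrable lebesgue (\<lambda>x. (2 * real n)\<^sup>2 * indicator {-(real n + 1)..real n + 1} x :: real)"
      by (intro integrable_mult_right) (simp add: integrable_indicator_iff)
    have "AE x in lebesgue. x \<notin> N" using N negligible_iff_null_sets AE_not_in by blast
    then show "AE x in lebesgue. (\<lambda>k. (cmod (f x - u k x))\<^sup>2) \<longlonglongrightarrow> 0"
    proof (rule AE_mp, intro AE_I2 impI)
      fix x assume "x \<notin> N"
      have "isCont cl (f x)" using cl by (simp add: continuous_on_eq_continuous_at)
      then have "(\<lambda>k. cl (g k x)) \<longlonglongrightarrow> cl (f x)" using lim[OF \<open>x \<notin> N\<close>] by (rule isCont_tendsto_compose)
      then have "(\<lambda>k. u k x) \<longlonglongrightarrow> of_real (cut x) * cl (f x)"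
        unfolding u_def by (intro tendsto_intros)
      moreover have "of_real (cut x) * cl (f x) = f x"
        unfolding clf using supp[of x] by (auto simp: cut_def)
      ultimately have "(\<lambda>k. (cmod (f x - u k x))\<^sup>2) \<longlonglongrightarrow> (cmod (f x - f x))\<^sup>2"
        by (intro tendsto_intros) simp
      then show "(\<lambda>k. (cmod (f x - u k x))\<^sup>2) \<longlonglongrightarrow> 0" by simp
    qed
    show "AE x in lebesgue. norm ((cmod (f x - u k x))\<^sup>2) \<le> (2 * real n)\<^sup>2 * indicator {-(real n + 1)..real n + 1} x" for k
    proof (intro AE_I2)
      fix x
      show "norm ((cmod (f x - u k x))\<^sup>2) \<le> (2 * real n)\<^sup>2 * indicator {-(real n + 1)..real n + 1} x"
      proof (cases "\<bar>x\<bar> \<le> real n + 1")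
        case True
        have "cmod (f x - u k x) \<le> 2 * real n"
          using norm_triangle_ineq4[of "f x" "u k x"] bd[of x] ub[of k x] by linarith
        then have "(cmod (f x - u k x))\<^sup>2 \<le> (2 * real n)\<^sup>2" by (intro power_mono) auto
        then show ?thesis using True by (auto simp: indicator_def)
      next
        case False
        then show ?thesis using supp[of x] us[of x k] by auto
      qed
    qed
  qed auto
  then have "\<forall>\<^sub>F k in sequentially. (LINT x|lebesgue. (cmod (f x - u k x))\<^sup>2) < e"
    using e by (intro order_tendstoD(2)) auto
  then obtain k where "(LINT x|lebesgue. (cmod (f x - u k x))\<^sup>2) < e" by (auto dest: eventually_happens)
  then show ?thesis using uD unfolding L2_norm_power2 by blast
qed

lemma compactly_supported_continuous_dense:
  assumes f: "f \<in> L2_functions" and e: "e > 0"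
  shows "\<exists>u\<in>compactly_supported_continuous. (L2_norm (\<lambda>x. f x - u x))\<^sup>2 < e"
proof -
  note [measurable] = f[THEN L2_functionsD(1)]
  have [measurable]: "(\<lambda>x::real. x) \<in> borel_measurable lebesgue" by (rule measurable_completion) simp
  obtain n :: nat where n: "n > 0"
    "(L2_norm (\<lambda>x. f x - (if \<bar>x\<bar> \<le> real n \<and> cmod (f x) \<le> real n then f x else 0)))\<^sup>2 < e / 4"
    using L2_truncation[OF f, of "e / 4"] e by auto
  define F where "F x = (if \<bar>x\<bar> \<le> real n \<and> cmod (f x) \<le> real n then f x else 0)" for x
  have Fm: "F \<in> borel_measurable lebesgue" unfolding F_def by measurable
  have Fb: "cmod (F x) \<le> real n" "real n < \<bar>x\<bar> \<Longrightarrow> F x = 0" for x by (auto simp: F_def)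
  obtain u where u: "u \<in> compactly_supported_continuous" "(L2_norm (\<lambda>x. F x - u x))\<^sup>2 < e / 4"
    using bounded_L2_approx[OF Fm n(1) _ _, of "e / 4"] e Fb by auto
  have "integrable lebesgue (\<lambda>x. (cmod (F x))\<^sup>2)"
    by (rule Bochner_Integration.integrable_bound[OF L2_functionsD(2)[OF f]]) (use Fm in \<open>auto simp: F_def\<close>)
  then have FL: "F \<in> L2_functions" using Fm by (simp add: L2_functions_def)
  have uL: "u \<in> L2_functions" using u compactly_supported_continuous_L2 by auto
  have "(L2_norm (\<lambda>x. (f x - F x) - (u x - F x)))\<^sup>2 \<le> 2 * (L2_norm (\<lambda>x. f x - F x))\<^sup>2 + 2 * (L2_norm (\<lambda>x. u x - F x))\<^sup>2"
    by (rule L2_norm_diff_power2_le) (intro L2_functions_diff f FL uL)+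
  also have "L2_norm (\<lambda>x. u x - F x) = L2_norm (\<lambda>x. F x - u x)" by (simp add: L2_norm_def norm_minus_commute)
  finally have "(L2_norm (\<lambda>x. f x - u x))\<^sup>2 < e" using n(2) u(2) by (simp add: F_def)
  with u(1) show ?thesis by blast
qed

section \<open>Frame bounds on the fibers\<close>

text \<open>
  For a product of a function of period \<open>1/2\<close> with another one, this collects the values of the second
  factor at \<open>s\<close> and \<open>s + 1/2\<close>.
\<close>

lemma integral_fold_half:
  fixes v :: "real \<Rightarrow> real"
  assumes v: "continuous_on {0..1} v"
  shows "integral {0..1} v = integral {0..1/2} (\<lambda>s. v s + v (s + 1/2))"
proof -
  have i: "v integrable_on {0..1}" by (rule integrable_continuous_interval[OF v])
  have "integral {0..1} v = integral {0..1/2} v + integral {1/2..1} v"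
    using Henstock_Kurzweil_Integration.integral_combine[of 0 "1/2" 1 v] i by simp
  also have "integral {1/2..1} v = integral {0..1/2} (\<lambda>s. v (s + 1/2))"
    using integral_shift_Icc_real[of 0 "1/2" v "1/2"] by (simp add: o_def add.commute)
  also have "integral {0..1/2} v + \<dots> = integral {0..1/2} (\<lambda>s. v s + v (s + 1/2))"
    by (rule Henstock_Kurzweil_Integration.integral_add[symmetric])
      (auto intro!: integrable_continuous_interval continuous_on_subset[OF v] continuous_on_compose2[OF v] continuous_intros)
  finally show ?thesis .
qed

definition window :: "real \<Rightarrow> real" where
  "window x = (x\<^sup>2 - 1) / ((x\<^sup>2 + 1) * (x\<^sup>2 + 4) * (x\<^sup>2 + 9))"

lemma window_denominator_pos: "0 < (x\<^sup>2 + 1) * (x\<^sup>2 + 4) * (x\<^sup>2 + (9::real))"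
  by (intro mult_pos_pos add_nonneg_pos) auto

lemma continuous_on_window [continuous_intros]:
  assumes "continuous_on S h" shows "continuous_on S (\<lambda>x. window (h x))"
  unfolding window_def using window_denominator_pos
  by (intro continuous_intros assms) (metis less_irrefl)

lemma window_partial_fractions:
  "1 / (2 * pi) / (1\<^sup>2 + x\<^sup>2) - 2 * (2 / (2 * pi) / (2\<^sup>2 + x\<^sup>2)) + 3 / (2 * pi) / (3\<^sup>2 + x\<^sup>2) = - (6 / pi) * window x"
proof -
  define T where "T = x\<^sup>2"
  have "T \<ge> 0" by (simp add: T_def)
  then have nz: "1 + T \<noteq> 0" "4 + T \<noteq> 0" "9 + T \<noteq> 0" by auto
  have "1 / (1 + T) - 4 / (4 + T) + 3 / (9 + T) = - 12 * ((T - 1) / ((T + 1) * (T + 4) * (T + 9)))"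
    using nz by (simp add: divide_simps add.commute) (simp add: algebra_simps)
  moreover have "1 / (2 * pi) / X - 2 * (2 / (2 * pi) / Y) + 3 / (2 * pi) / Z = (1 / (2 * pi)) * (1 / X - 4 / Y + 3 / Z)"
    for X Y Z by (simp add: right_diff_distrib distrib_left)
  moreover have "(2::real)\<^sup>2 = 4" "(3::real)\<^sup>2 = 9" by simp_all
  ultimately have "1 / (2 * pi) / (1\<^sup>2 + T) - 2 * (2 / (2 * pi) / (2\<^sup>2 + T)) + 3 / (2 * pi) / (3\<^sup>2 + T)
      = (1 / (2 * pi)) * (- 12 * ((T - 1) / ((T + 1) * (T + 4) * (T + 9))))" by (simp only: power_one)
  moreover have "(1 / (2 * pi)) * (- 12 * W) = - (6 / pi) * W" for W by simp
  ultimately show ?thesis unfolding window_def T_def[symmetric] by (simp only:)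
qed

lemma fourier_coeff_gabor_symbol:
  "fourier_coeff (\<lambda>s. cis (4 * pi * x * s) * gabor_symbol (cis (4 * pi * x)) s) l
    = of_real (- (6 / pi) * window (x - of_int l / 2))"
proof -
  let ?f = "\<lambda>k s. cis (4 * pi * x * s) * exp_zak k (cis (4 * pi * x)) s"
  have c: "continuous_on {0..1} (?f k)" if "k > 0" for k
    by (intro continuous_intros that) auto
  note h = has_integral_fourier_coeff[OF c]
  have "((\<lambda>s. ?f 1 s * cis (- (2 * pi * of_int l * s)) - 2 * (?f 2 s * cis (- (2 * pi * of_int l * s)))
        + ?f 3 s * cis (- (2 * pi * of_int l * s))) has_integral
      fourier_coeff (?f 1) l - 2 * fourier_coeff (?f 2) l + fourier_coeff (?f 3) l) {0..1}"
    by (intro has_integral_add has_integral_diff has_integral_mult_right h) auto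
  then have "fourier_coeff (\<lambda>s. cis (4 * pi * x * s) * gabor_symbol (cis (4 * pi * x)) s) l
      = fourier_coeff (?f 1) l - 2 * fourier_coeff (?f 2) l + fourier_coeff (?f 3) l"
    unfolding fourier_coeff_def[of "\<lambda>s. cis (4 * pi * x * s) * gabor_symbol (cis (4 * pi * x)) s"]
    by (intro integral_unique) (simp add: gabor_symbol_def algebra_simps)
  also have "\<dots> = of_real (1 / (2 * pi) / (1\<^sup>2 + (x - of_int l / 2)\<^sup>2) - 2 * (2 / (2 * pi) / (2\<^sup>2 + (x - of_int l / 2)\<^sup>2))
      + 3 / (2 * pi) / (3\<^sup>2 + (x - of_int l / 2)\<^sup>2))"
    by (simp only: fourier_coeff_exp_zak zero_less_one zero_less_numeral of_real_add of_real_diff of_real_mult of_real_numeral)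
  finally show ?thesis unfolding window_partial_fractions .
qed

text \<open>
  The numbers \<open>\<Sum>n\<in>S. c n * window (x + n - k / 2)\<close> are a convolution of \<open>c\<close>, placed at the even
  integers, with the sequence \<open>window (x - l / 2)\<close>. Up to the factor \<open>- 6 / pi\<close> they are thus the
  Fourier coefficients of the product of the two corresponding functions, to which Parseval's identity applies.
\<close>

lemma window_sum_fourier:
  fixes c :: "int \<Rightarrow> complex"
  assumes S: "finite S"
  defines "F \<equiv> \<lambda>x s. (\<Sum>n\<in>S. c n * cis (2 * pi * of_int (2 * n) * s)) * (cis (4 * pi * x * s) * gabor_symbol (cis (4 * pi * x)) s)"
  shows "((\<lambda>k. (cmod (\<Sum>n\<in>S. c n * of_real (window (x + of_int n - of_int k / 2))))\<^sup>2)
    has_sum (pi\<^sup>2 / 36 * integral {0..1} (\<lambda>s. (cmod (F x s))\<^sup>2))) UNIV"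
proof -
  let ?H = "\<lambda>s. cis (4 * pi * x * s) * gabor_symbol (cis (4 * pi * x)) s"
  have cH: "continuous_on {0..1} ?H" by (intro continuous_intros) auto
  have cF: "continuous_on {0..1} (F x)" unfolding F_def by (intro continuous_intros) auto
  have "cis (4 * pi * x) * gabor_symbol (cis (4 * pi * x)) 1 = gabor_symbol (cis (4 * pi * x)) 0"
    using exp_zak_endpoints[of "cis (4 * pi * x)" 1] exp_zak_endpoints[of "cis (4 * pi * x)" 2]
      exp_zak_endpoints[of "cis (4 * pi * x)" 3]
    by (simp add: gabor_symbol_def algebra_simps)
  moreover have "cis (2 * pi * of_int (2 * n) * 1) = 1" for n
    using cis_multiple_2pi[of "of_int (2 * n)"] by simp
  ultimately have per: "F x 0 = F x 1" unfolding F_def by simp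
  have co: "fourier_coeff (F x) k = of_real (- (6 / pi)) * (\<Sum>n\<in>S. c n * of_real (window (x + of_int n - of_int k / 2)))" for k
  proof -
    have "((\<lambda>s. \<Sum>n\<in>S. c n * (?H s * cis (- (2 * pi * of_int (k - 2 * n) * s)))) has_integral
        (\<Sum>n\<in>S. c n * fourier_coeff ?H (k - 2 * n))) {0..1}"
      by (intro has_integral_sum has_integral_mult_right has_integral_fourier_coeff cH S)
    also have "(\<lambda>s. \<Sum>n\<in>S. c n * (?H s * cis (- (2 * pi * of_int (k - 2 * n) * s))))
        = (\<lambda>s. F x s * cis (- (2 * pi * of_int k * s)))"
    proof
      fix s
      have e: "cis (- (2 * pi * of_int (k - 2 * n) * s)) = cis (2 * pi * of_int (2 * n) * s) * cis (- (2 * pi * of_int k * s))" for n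
        by (simp add: cis_mult algebra_simps)
      show "(\<Sum>n\<in>S. c n * (?H s * cis (- (2 * pi * of_int (k - 2 * n) * s)))) = F x s * cis (- (2 * pi * of_int k * s))"
        unfolding F_def sum_distrib_right e by (intro sum.cong) (simp_all only: mult_ac)
    qed
    finally have "fourier_coeff (F x) k = (\<Sum>n\<in>S. c n * fourier_coeff ?H (k - 2 * n))"
      unfolding fourier_coeff_def[of "F x"] by (rule integral_unique)
    also have "\<dots> = of_real (- (6 / pi)) * (\<Sum>n\<in>S. c n * of_real (window (x + of_int n - of_int k / 2)))"
      unfolding fourier_coeff_gabor_symbol sum_distrib_left
      by (intro sum.cong) (simp_all add: field_simps)
    finally show ?thesis .
  qed
  have "(\<lambda>k. pi\<^sup>2 / 36 * (cmod (fourier_coeff (F x) k))\<^sup>2)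
      = (\<lambda>k. (cmod (\<Sum>n\<in>S. c n * of_real (window (x + of_int n - of_int k / 2))))\<^sup>2)"
    unfolding co norm_mult power_mult_distrib norm_of_real power2_abs by (simp add: field_simps power2_eq_square)
  then show ?thesis
    using has_sum_cmult_right[OF parseval[OF cF per], of "pi\<^sup>2 / 36"] by simp
qed

text \<open>
  The trigonometric polynomial with the coefficients \<open>c\<close> at even frequencies has period \<open>1/2\<close>. Folding the
  integral therefore leaves its squared modulus times the quantity bounded in \<open>gabor_symbol_bounds\<close>.
\<close>

lemma window_sum_bounds:
  obtains A B where "A > 0" "B > 0"
    "\<And>c S x. finite S \<Longrightarrow> \<exists>V. ((\<lambda>k::int. (cmod (\<Sum>n\<in>S. c n * of_real (window (x + of_int n - of_int k / 2))))\<^sup>2) has_sum V) UNIV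
       \<and> A * (\<Sum>n\<in>S. (cmod (c n))\<^sup>2) \<le> V \<and> V \<le> B * (\<Sum>n\<in>S. (cmod (c n))\<^sup>2)"
proof (rule gabor_symbol_bounds)
  fix a b :: real
  assume ab: "a > 0" "b > 0"
    and lo: "\<And>z s. cmod z = 1 \<Longrightarrow> s \<in> {0..1/2} \<Longrightarrow> a \<le> (cmod (gabor_symbol z s))\<^sup>2 + (cmod (gabor_symbol z (s + 1/2)))\<^sup>2"
    and up: "\<And>z s. cmod z = 1 \<Longrightarrow> s \<in> {0..1/2} \<Longrightarrow> (cmod (gabor_symbol z s))\<^sup>2 + (cmod (gabor_symbol z (s + 1/2)))\<^sup>2 \<le> b"
  show thesis
  proof (rule that[of "pi\<^sup>2 / 36 * (a / 2)" "pi\<^sup>2 / 36 * (b / 2)"])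
    fix c :: "int \<Rightarrow> complex" and S x
    assume S: "finite (S :: int set)"
    define C where "C s = (\<Sum>n\<in>S. c n * cis (2 * pi * of_int (2 * n) * s))" for s
    let ?z = "cis (4 * pi * x)"
    let ?I = "integral {0..1} (\<lambda>s. (cmod (C s * (cis (4 * pi * x * s) * gabor_symbol ?z s)))\<^sup>2)"
    let ?W = "\<lambda>s. (cmod (gabor_symbol ?z s))\<^sup>2 + (cmod (gabor_symbol ?z (s + 1/2)))\<^sup>2"
    have Cc [continuous_intros]: "continuous_on T C" for T unfolding C_def by (intro continuous_intros)
    have Cp: "C (s + 1/2) = C s" for s
    proof -
      have "cis (2 * pi * of_int (2 * n) * (s + 1/2)) = cis (2 * pi * of_int (2 * n) * s)" for n
      proof -
        have "cis (2 * pi * of_int (2 * n) * (s + 1/2)) = cis (2 * pi * of_int (2 * n) * s) * cis (2 * pi * of_int n)"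
          by (subst cis_mult) (simp add: algebra_simps)
        then show ?thesis by simp
      qed
      then show ?thesis unfolding C_def by simp
    qed
    have "integral {0..1} (\<lambda>s. (cmod (C s))\<^sup>2) = (\<Sum>n\<in>S. (cmod (c n))\<^sup>2)"
      unfolding C_def by (rule integral_cmod_trig_poly[OF S]) (auto simp: inj_on_def)
    moreover have "integral {0..1} (\<lambda>s. (cmod (C s))\<^sup>2) = integral {0..1/2} (\<lambda>s. (cmod (C s))\<^sup>2 + (cmod (C (s + 1/2)))\<^sup>2)"
      by (rule integral_fold_half) (intro continuous_intros)
    ultimately have C2: "integral {0..1/2} (\<lambda>s. (cmod (C s))\<^sup>2) = (\<Sum>n\<in>S. (cmod (c n))\<^sup>2) / 2"
      unfolding Cp by simp
    have "?I = integral {0..1} (\<lambda>s. (cmod (C s))\<^sup>2 * (cmod (gabor_symbol ?z s))\<^sup>2)"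
      by (simp add: norm_mult power_mult_distrib)
    also have "\<dots> = integral {0..1/2} (\<lambda>s. (cmod (C s))\<^sup>2 * (cmod (gabor_symbol ?z s))\<^sup>2
        + (cmod (C (s + 1/2)))\<^sup>2 * (cmod (gabor_symbol ?z (s + 1/2)))\<^sup>2)"
      by (rule integral_fold_half) (intro continuous_intros, auto)
    also have "\<dots> = integral {0..1/2} (\<lambda>s. ?W s * (cmod (C s))\<^sup>2)"
      unfolding Cp by (simp add: algebra_simps)
    finally have I: "?I = integral {0..1/2} (\<lambda>s. ?W s * (cmod (C s))\<^sup>2)" .
    have i: "(\<lambda>s. ?W s * (cmod (C s))\<^sup>2) integrable_on {0..1/2}"
      by (rule integrable_continuous_interval) (intro continuous_intros, auto)
    have iC: "(\<lambda>s. k * (cmod (C s))\<^sup>2) integrable_on {0..1/2}" for k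
      by (rule integrable_continuous_interval) (intro continuous_intros)
    have "integral {0..1/2} (\<lambda>s. a * (cmod (C s))\<^sup>2) \<le> ?I" unfolding I
      by (rule integral_le[OF iC i]) (auto intro!: mult_right_mono lo)
    moreover have "?I \<le> integral {0..1/2} (\<lambda>s. b * (cmod (C s))\<^sup>2)" unfolding I
      by (rule integral_le[OF i iC]) (auto intro!: mult_right_mono up)
    ultimately have "a / 2 * (\<Sum>n\<in>S. (cmod (c n))\<^sup>2) \<le> ?I" "?I \<le> b / 2 * (\<Sum>n\<in>S. (cmod (c n))\<^sup>2)"
      by (simp_all add: C2)
    then have "pi\<^sup>2 / 36 * (a / 2 * (\<Sum>n\<in>S. (cmod (c n))\<^sup>2)) \<le> pi\<^sup>2 / 36 * ?I" "pi\<^sup>2 / 36 * ?I \<le> pi\<^sup>2 / 36 * (b / 2 * (\<Sum>n\<in>S. (cmod (c n))\<^sup>2))"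
      by (intro mult_left_mono; simp)+
    then show "\<exists>V. ((\<lambda>k::int. (cmod (\<Sum>n\<in>S. c n * of_real (window (x + of_int n - of_int k / 2))))\<^sup>2) has_sum V) UNIV
       \<and> pi\<^sup>2 / 36 * (a / 2) * (\<Sum>n\<in>S. (cmod (c n))\<^sup>2) \<le> V \<and> V \<le> pi\<^sup>2 / 36 * (b / 2) * (\<Sum>n\<in>S. (cmod (c n))\<^sup>2)"
      using window_sum_fourier[OF S, of c x] unfolding C_def by (intro exI conjI) (auto simp: mult.assoc)
  qed (use ab in auto)
qed

lemma integrable_inverse_one_plus_square: "integrable lborel (\<lambda>x::real. inverse (1 + (x - t)\<^sup>2))"
proof -
  have "set_integrable lborel (einterval (- \<infinity>) \<infinity>) (\<lambda>x::real. inverse (1 + (x - t)\<^sup>2))"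
  proof (rule interval_integral_FTC_nonneg(1)[where F = "\<lambda>x. arctan (x - t)" and A = "- (pi/2)" and B = "pi/2"])
    show "DERIV (\<lambda>x. arctan (x - t)) x :> inverse (1 + (x - t)\<^sup>2)" for x
      by (auto intro!: derivative_eq_intros)
    show "isCont (\<lambda>x. inverse (1 + (x - t)\<^sup>2)) x" for x
      by (intro continuous_intros) (metis power_one sum_power2_eq_zero_iff zero_neq_one)
    have "filterlim (\<lambda>x. x - t) at_bot at_bot"
      unfolding filterlim_at_bot
    proof (rule allI)
      fix Z show "\<forall>\<^sub>F x in at_bot. x - t \<le> Z"
        using eventually_le_at_bot[of "Z + t"] by eventually_elim simp
    qed
    then have 1: "((\<lambda>x. arctan (x - t)) \<longlongrightarrow> - (pi/2)) at_bot"
      by (rule filterlim_compose[OF tendsto_arctan_at_bot])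
    have 2: "((\<lambda>x. arctan (x - t)) \<longlongrightarrow> pi/2) at_top"
      using filterlim_compose[OF tendsto_arctan_at_top filterlim_tendsto_add_at_top[OF tendsto_const filterlim_ident, of "- t"]]
      by (simp add: algebra_simps)
    show "(((\<lambda>x. arctan (x - t)) \<circ> real_of_ereal) \<longlongrightarrow> - (pi/2)) (at_right (- \<infinity>))"
      "(((\<lambda>x. arctan (x - t)) \<circ> real_of_ereal) \<longlongrightarrow> pi/2) (at_left \<infinity>)"
      using 1 2 by (simp_all add: ereal_tendsto_simps1)
  qed auto
  then show ?thesis by (simp add: set_integrable_def)
qed

lemma window_square_le: "(window x)\<^sup>2 \<le> inverse (1 + x\<^sup>2)"
proof -
  have "\<bar>window x\<bar> \<le> 1 / (1 + x\<^sup>2)"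
  proof -
    have "\<bar>x\<^sup>2 - 1\<bar> \<le> (x\<^sup>2 + 4) * 1" by (auto simp: abs_le_iff)
    also have "\<dots> \<le> (x\<^sup>2 + 4) * (x\<^sup>2 + 9)" by (intro mult_left_mono) auto
    finally have le: "\<bar>x\<^sup>2 - 1\<bar> \<le> (x\<^sup>2 + 4) * (x\<^sup>2 + 9)" .
    have "\<bar>window x\<bar> = \<bar>x\<^sup>2 - 1\<bar> / ((x\<^sup>2 + 1) * (x\<^sup>2 + 4) * (x\<^sup>2 + 9))"
      unfolding window_def abs_divide abs_of_pos[OF window_denominator_pos] ..
    also have "\<dots> \<le> ((x\<^sup>2 + 4) * (x\<^sup>2 + 9)) / ((x\<^sup>2 + 1) * (x\<^sup>2 + 4) * (x\<^sup>2 + 9))"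
      using window_denominator_pos[of x] by (intro divide_right_mono le) simp
    also have "\<dots> = 1 / (1 + x\<^sup>2)"
    proof -
      have "x\<^sup>2 + 4 \<noteq> 0" "x\<^sup>2 + 9 \<noteq> 0" using zero_le_power2[of x] by linarith+
      then show ?thesis by (simp add: add.commute mult.assoc)
    qed
    finally show ?thesis .
  qed
  then have "\<bar>window x\<bar>\<^sup>2 \<le> (1 / (1 + x\<^sup>2))\<^sup>2" by (intro power_mono) auto
  also have "\<dots> \<le> (1 / (1 + x\<^sup>2)) * 1" unfolding power2_eq_square[of "1 / _"]
    by (intro mult_left_mono) (auto simp: divide_le_eq_1_pos add_pos_nonneg)
  finally show ?thesis by (simp add: divide_inverse)
qed

lemma gabor_system_window:
  "gabor_system (\<lambda>x. of_real (window x)) (1/2) 1 (k, m) x = cis (2 * pi * of_int m * x) * of_real (window (x - of_int k / 2))"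
  by (simp add: gabor_system_def cis_conv_exp mult_ac)

lemma gabor_system_window_L2: "range (gabor_system (\<lambda>x. of_real (window x)) (1/2) 1) \<subseteq> L2_functions"
proof safe
  fix k m
  let ?h = "gabor_system (\<lambda>x. of_real (window x)) (1/2) 1 (k, m)"
  have c: "continuous_on UNIV ?h"
    unfolding gabor_system_window[abs_def] by (intro continuous_intros)
  then have hm: "?h \<in> borel_measurable borel" by (rule borel_measurable_continuous_onI)
  have "integrable lborel (\<lambda>x. (cmod (?h x))\<^sup>2)"
  proof (rule Bochner_Integration.integrable_bound[OF integrable_inverse_one_plus_square[of "of_int k / 2"]])
    show "(\<lambda>x. (cmod (?h x))\<^sup>2) \<in> borel_measurable lborel" using hm by measurable
    show "AE x in lborel. norm ((cmod (?h x))\<^sup>2) \<le> norm (inverse (1 + (x - of_int k / 2)\<^sup>2))"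
      using window_square_le by (auto simp: gabor_system_window norm_mult add_nonneg_nonneg)
  qed
  then have "integrable lebesgue (\<lambda>x. (cmod (?h x))\<^sup>2)"
    using hm by (subst integrable_completion) auto
  moreover have "?h \<in> borel_measurable lebesgue" using hm by (intro measurable_completion) simp
  ultimately show "?h \<in> L2_functions" by (simp add: L2_functions_def)
qed

section \<open>The Gabor system\<close>

lemma integral_unit_intervals:
  fixes v :: "real \<Rightarrow> 'b::euclidean_space"
  assumes v: "continuous_on UNIV v"
  shows "integral {a..a + real N} v = integral {0..1} (\<lambda>x. \<Sum>i<N. v (x + (a + real i)))"
proof (induction N)
  case (Suc N)
  have i: "v integrable_on {c..d}" for c d
    by (rule integrable_continuous_interval) (rule continuous_on_subset[OF v], simp)
  have ic: "(\<lambda>x. \<Sum>i<K. v (x + (a + real i))) integrable_on {0..1}" "(\<lambda>x. v (x + (a + real K))) integrable_on {0..1}" for K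
    by (auto intro!: integrable_continuous_interval continuous_intros continuous_on_compose2[OF v])
  have "integral {a..a + real (Suc N)} v = integral {a..a + real N} v + integral {a + real N..a + real (Suc N)} v"
    by (rule Henstock_Kurzweil_Integration.integral_combine[symmetric]) (auto intro: i)
  also have "integral {a + real N..a + real (Suc N)} v = integral {0..1} (\<lambda>x. v (x + (a + real N)))"
    using integral_shift_Icc_real[of 0 1 v "a + real N"] by (simp add: o_def add_ac)
  finally show ?case unfolding Suc.IH sum.lessThan_Suc
    using Henstock_Kurzweil_Integration.integral_add[OF ic(1)[of N] ic(2)[of N]] by simp
qed simp

lemma lebesgue_integral_periodization:
  fixes v :: "real \<Rightarrow> 'b::euclidean_space"
  assumes v: "continuous_on UNIV v" and M: "\<And>x. real M \<le> \<bar>x\<bar> \<Longrightarrow> v x = 0"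
  shows "(LINT x|lebesgue. v x) = integral {0..1} (\<lambda>x. \<Sum>n\<in>{- int M..<int M}. v (x + of_int n))"
proof -
  have "(\<Sum>n\<in>{- int M..<int M}. v (x + of_int n)) = (\<Sum>i<2 * M. v (x + (- real M + real i)))" for x
    by (rule sum.reindex_bij_witness[of _ "\<lambda>i. int i - int M" "\<lambda>n. nat (n + int M)"])
      (auto simp: algebra_simps)
  moreover have "- real M + real (2 * M) = real M" by simp
  ultimately show ?thesis
    using integral_unit_intervals[OF v, of "- real M" "2 * M"] lebesgue_integral_compact_support(2)[OF v M] by simp
qed

lemma L2_norm_periodization:
  assumes u: "continuous_on UNIV u" and M: "\<And>x. real M \<le> \<bar>x\<bar> \<Longrightarrow> u x = 0"
  shows "(L2_norm u)\<^sup>2 = integral {0..1} (\<lambda>x. \<Sum>n\<in>{- int M..<int M}. (cmod (u (x + of_int n)))\<^sup>2)"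
  unfolding L2_norm_power2 by (rule lebesgue_integral_periodization) (auto intro!: continuous_intros u simp: M)

text \<open>
  Periodization of \<open>u\<close> times a translate of the window. The range of \<open>n\<close> contains all nonzero terms
  for \<open>0 \<le> x \<le> 1\<close> if \<open>u\<close> vanishes outside of \<open>{- M<..<M}\<close>.
\<close>

definition gabor_fiber :: "nat \<Rightarrow> (real \<Rightarrow> complex) \<Rightarrow> int \<Rightarrow> real \<Rightarrow> complex" where
  "gabor_fiber M u k x = (\<Sum>n\<in>{- int M..<int M}. u (x + of_int n) * of_real (window (x + of_int n - of_int k / 2)))"

lemma continuous_on_gabor_fiber [continuous_intros]:
  assumes u: "continuous_on UNIV u" shows "continuous_on S (gabor_fiber M u k)"
  unfolding gabor_fiber_def[abs_def] by (intro continuous_intros continuous_on_compose2[OF u]) auto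

text \<open>
  The two finite sums differ by a shift of the index, which only brings in terms at \<open>- M\<close> and \<open>M\<close>,
  where \<open>u\<close> vanishes.
\<close>

lemma gabor_fiber_periodic:
  assumes M: "\<And>x. real M \<le> \<bar>x\<bar> \<Longrightarrow> u x = 0"
  shows "gabor_fiber M u k 0 = gabor_fiber M u k 1"
proof -
  define w where "w n = u (of_int n) * complex_of_real (window (of_int n - of_int k / 2))" for n :: int
  have w0: "w (int M) = 0" "w (- int M) = 0" by (simp_all add: w_def M)
  have "(\<Sum>n\<in>{- int M..<int M}. w (n + 1)) = (\<Sum>n\<in>{- int M + 1..<int M + 1}. w n)"
    by (rule sum.reindex_bij_witness[of _ "\<lambda>n. n - 1" "\<lambda>n. n + 1"]) auto
  also have "\<dots> = (\<Sum>n\<in>{- int M..int M}. w n)"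
    by (rule sum.mono_neutral_left) (use w0 in \<open>auto simp: not_le dest!: order.antisym\<close>)
  also have "\<dots> = (\<Sum>n\<in>{- int M..<int M}. w n)"
    by (rule sum.mono_neutral_right) (use w0 in \<open>auto simp: not_less dest!: order.antisym\<close>)
  finally show ?thesis by (simp add: gabor_fiber_def w_def add.commute)
qed

text \<open>
  The modulation has period 1, so that periodizing the integrand affects only \<open>u\<close> and the window.
\<close>

lemma L2_inner_gabor_system_window:
  assumes u: "continuous_on UNIV u" and M: "\<And>x. real M \<le> \<bar>x\<bar> \<Longrightarrow> u x = 0"
  shows "L2_inner u (gabor_system (\<lambda>x. of_real (window x)) (1/2) 1 (k, m)) = fourier_coeff (gabor_fiber M u k) m"
proof -
  let ?v = "\<lambda>x. u x * cnj (gabor_system (\<lambda>x. of_real (window x)) (1/2) 1 (k, m) x)"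
  have "continuous_on UNIV ?v" unfolding gabor_system_window by (intro continuous_intros u)
  then have "L2_inner u (gabor_system (\<lambda>x. of_real (window x)) (1/2) 1 (k, m))
      = integral {0..1} (\<lambda>x. \<Sum>n\<in>{- int M..<int M}. ?v (x + of_int n))"
    unfolding L2_inner_def by (rule lebesgue_integral_periodization) (simp add: M)
  also have "(\<lambda>x. \<Sum>n\<in>{- int M..<int M}. ?v (x + of_int n)) = (\<lambda>x. gabor_fiber M u k x * cis (- (2 * pi * of_int m * x)))"
  proof
    fix x
    have "cis (- (2 * pi * of_int m * (x + of_int n))) = cis (- (2 * pi * of_int m * x))" for n
    proof -
      have "cis (- (2 * pi * of_int m * (x + of_int n))) = cis (- (2 * pi * of_int m * x)) * cis (2 * pi * of_int (- m * n))"
        by (subst cis_mult) (simp add: algebra_simps)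
      then show ?thesis using cis_multiple_2pi[of "of_int (- m * n)"] by simp
    qed
    then have v: "?v (x + of_int n) = u (x + of_int n) * of_real (window (x + of_int n - of_int k / 2)) * cis (- (2 * pi * of_int m * x))" for n
      unfolding gabor_system_window by (simp add: cis_cnj)
    show "(\<Sum>n\<in>{- int M..<int M}. ?v (x + of_int n)) = gabor_fiber M u k x * cis (- (2 * pi * of_int m * x))"
      unfolding v gabor_fiber_def sum_distrib_right ..
  qed
  finally show ?thesis unfolding fourier_coeff_def .
qed

text \<open>
  For each \<open>k\<close>, Parseval's identity evaluates the sum over \<open>m\<close>. For the upper bound, finitely many \<open>k\<close>
  are summed under the integral. The lower bound involves all \<open>k\<close> at once, and the integral and the
  sum are exchanged by monotone convergence along an enumeration of the integers.
\<close>

lemma gabor_frame_window: "L2_frame (gabor_system (\<lambda>x. of_real (window x)) (1/2) 1)"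
proof (rule window_sum_bounds)
  fix A B :: real
  assume AB: "A > 0" "B > 0" and bounds: "\<And>c S x. finite S \<Longrightarrow>
      \<exists>V. ((\<lambda>k::int. (cmod (\<Sum>n\<in>S. c n * of_real (window (x + of_int n - of_int k / 2))))\<^sup>2) has_sum V) UNIV
       \<and> A * (\<Sum>n\<in>S. (cmod (c n))\<^sup>2) \<le> V \<and> V \<le> B * (\<Sum>n\<in>S. (cmod (c n))\<^sup>2)"
  let ?h = "gabor_system (\<lambda>x. of_real (window x)) (1/2) 1"
  show ?thesis
  proof (rule L2_frame_if_dense[OF gabor_system_window_L2 compactly_supported_continuous_L2 compactly_supported_continuous_dense AB])
    fix u assume "u \<in> compactly_supported_continuous"
    then obtain M where u: "continuous_on UNIV u" and M: "\<And>x. real M \<le> \<bar>x\<bar> \<Longrightarrow> u x = 0"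
      by (auto simp: compactly_supported_continuous_def)
    define P where "P = gabor_fiber M u"
    define I where "I k = integral {0..1} (\<lambda>x. (cmod (P k x))\<^sup>2)" for k
    define N where "N x = (\<Sum>n\<in>{- int M..<int M}. (cmod (u (x + of_int n)))\<^sup>2)" for x
    have Pc: "continuous_on S (P k)" for k S unfolding P_def by (intro continuous_intros u)
    have Nc: "continuous_on S N" for S unfolding N_def by (intro continuous_intros continuous_on_compose2[OF u]) auto
    have norm_u: "(L2_norm u)\<^sup>2 = integral {0..1} N" unfolding N_def by (rule L2_norm_periodization[OF u M])
    have Pi: "(\<lambda>x. (cmod (P k x))\<^sup>2) integrable_on {0..1}" for k
      by (rule integrable_continuous_interval) (intro continuous_intros Pc)
    have Ni: "(\<lambda>x. c * N x) integrable_on {0..1}" for c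
      by (rule integrable_continuous_interval) (intro continuous_intros Nc)
    have inner: "(cmod (L2_inner u (?h (k, m))))\<^sup>2 = (cmod (fourier_coeff (P k) m))\<^sup>2" for k m
      unfolding P_def using L2_inner_gabor_system_window[OF u M] by simp
    have row: "((\<lambda>m. (cmod (L2_inner u (?h (k, m))))\<^sup>2) has_sum I k) UNIV" for k
      unfolding inner I_def
      by (rule parseval[OF Pc]) (use gabor_fiber_periodic[OF M] in \<open>auto simp: P_def\<close>)
    have "\<exists>V. \<forall>x. ((\<lambda>k. (cmod (P k x))\<^sup>2) has_sum V x) UNIV \<and> A * N x \<le> V x \<and> V x \<le> B * N x"
      unfolding P_def N_def gabor_fiber_def by (intro choice allI bounds) simp
    then obtain V where V: "\<And>x. ((\<lambda>k. (cmod (P k x))\<^sup>2) has_sum V x) UNIV" "\<And>x. A * N x \<le> V x" "\<And>x. V x \<le> B * N x"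
      by blast
    have colsum: "sum I K \<le> B * (L2_norm u)\<^sup>2" if K: "finite K" for K
    proof -
      have "sum I K = integral {0..1} (\<lambda>x. \<Sum>k\<in>K. (cmod (P k x))\<^sup>2)"
        unfolding I_def by (rule integral_sum[symmetric]) (use K Pi in auto)
      also have "\<dots> \<le> integral {0..1} (\<lambda>x. B * N x)"
      proof (rule integral_le)
        show "(\<lambda>x. \<Sum>k\<in>K. (cmod (P k x))\<^sup>2) integrable_on {0..1}" using K Pi by (intro integrable_sum) auto
        show "(\<Sum>k\<in>K. (cmod (P k x))\<^sup>2) \<le> B * N x" for x
          using finite_sum_le_has_sum[OF V(1)[of x] K] V(3)[of x] by fastforce
      qed (rule Ni)
      finally show ?thesis by (simp add: norm_u)
    qed
    show up: "(\<Sum>i\<in>F. (cmod (L2_inner u (?h i)))\<^sup>2) \<le> B * (L2_norm u)\<^sup>2" if F: "finite F" for F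
    proof -
      have "(\<Sum>i\<in>F. (cmod (L2_inner u (?h i)))\<^sup>2) \<le> (\<Sum>i\<in>fst ` F \<times> snd ` F. (cmod (L2_inner u (?h i)))\<^sup>2)"
        by (rule sum_mono2) (use F in \<open>auto intro!: rev_image_eqI\<close>)
      also have "\<dots> = (\<Sum>k\<in>fst ` F. \<Sum>m\<in>snd ` F. (cmod (L2_inner u (?h (k, m))))\<^sup>2)"
        by (simp add: sum.cartesian_product)
      also have "\<dots> \<le> sum I (fst ` F)"
        by (intro sum_mono finite_sum_le_has_sum[OF row]) (use F in auto)
      also have "\<dots> \<le> B * (L2_norm u)\<^sup>2" using F by (intro colsum) simp
      finally show ?thesis .
    qed
    let ?\<Phi> = "\<Sum>\<^sub>\<infinity>i. (cmod (L2_inner u (?h i)))\<^sup>2"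
    have "(\<lambda>i. (cmod (L2_inner u (?h i)))\<^sup>2) summable_on UNIV"
      using up by (intro nonneg_bdd_above_summable_on bdd_aboveI2) auto
    then have "((\<lambda>i. (cmod (L2_inner u (?h i)))\<^sup>2) has_sum ?\<Phi>) (UNIV \<times> UNIV)" by simp
    then have "(I has_sum ?\<Phi>) UNIV" by (rule has_sum_SigmaD) (rule row)
    then have "((\<lambda>j. I (int_decode j)) has_sum ?\<Phi>) UNIV"
      by (simp add: has_sum_reindex_bij_betw[OF bij_int_decode])
    then have le: "(\<Sum>j<J. I (int_decode j)) \<le> ?\<Phi>" for J
      by (rule finite_sum_le_has_sum) (auto simp: I_def intro: integral_nonneg Pi)
    let ?G = "\<lambda>J x. \<Sum>j<J. (cmod (P (int_decode j) x))\<^sup>2"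
    have IG: "integral {0..1} (?G J) = (\<Sum>j<J. I (int_decode j))" for J
      unfolding I_def by (rule integral_sum) (use Pi in auto)
    have conv: "V integrable_on {0..1} \<and> (\<lambda>J. integral {0..1} (?G J)) \<longlonglongrightarrow> integral {0..1} V"
    proof (rule monotone_convergence_increasing)
      show "?G J integrable_on {0..1}" for J by (intro integrable_sum Pi) auto
      show "(\<lambda>J. ?G J x) \<longlonglongrightarrow> V x" for x
      proof -
        have "((\<lambda>j. (cmod (P (int_decode j) x))\<^sup>2) has_sum V x) UNIV"
          by (rule has_sum_reindex_bij_betw[OF bij_int_decode, THEN iffD2]) (rule V(1))
        from has_sum_imp_sums[OF this] show ?thesis by (simp add: sums_def)
      qed
      have "\<bar>integral {0..1} (?G J)\<bar> \<le> ?\<Phi>" for J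
      proof -
        have "0 \<le> integral {0..1} (?G J)" by (intro integral_nonneg integrable_sum Pi sum_nonneg) auto
        with le[of J] show ?thesis unfolding IG by simp
      qed
      then show "bounded (range (\<lambda>J. integral {0..1} (?G J)))" by (auto simp: bounded_iff)
    qed simp
    have "A * (L2_norm u)\<^sup>2 = integral {0..1} (\<lambda>x. A * N x)" by (simp add: norm_u)
    also have "\<dots> \<le> integral {0..1} V" using conv V(2) by (intro integral_le Ni) auto
    also have "\<dots> \<le> ?\<Phi>"
      by (rule LIMSEQ_le_const2[OF conjunct2[OF conv]]) (use le in \<open>auto simp: IG\<close>)
    finally show "A * (L2_norm u)\<^sup>2 \<le> ?\<Phi>" .
  qed
qed

theorem proposition3p1:
  fixes g :: "real \<Rightarrow> real"
  assumes g_def: "\<And>x. g x = (x\<^sup>2 - 1) / ((x\<^sup>2 + 1) * (x\<^sup>2 + 4) * (x\<^sup>2 + 9))"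
  shows "(1/2, 1) \<in> gabor_frame_set (\<lambda>x. complex_of_real (g x))"
proof -
  have "g = window" by (rule ext) (simp add: g_def window_def)
  then show ?thesis using gabor_frame_window by (simp add: gabor_frame_set_def)
qed

end
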